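(* Let $z_0\in(0,1)$, $L>0$, $\varsigma\ge 1$, $\beta=1+\alpha$ with $0<\alpha<1$, and let $(\epsilon^*_n)_{n\ge1}$ be a sequence of positive numbers with $\epsilon_n^*\to 0$. Then for any $0<\varepsilon<1$ $$\liminf_{n\to\infty}\ \inf_{\tilde S_n}\ \sup_{S\in\mathcal U_n^{(\beta)}(\varepsilon,L,\epsilon_n^* )}\ \gamma(S)^{-1/2}\,\varphi_n\,\mathcal R_n(\tilde S_n,S)\ \ge\ \mathbf E|\eta|,$$ where $\varphi_n=n^{\beta/(2\beta+1)}$, $\gamma(S)=1-S^2(z_0)$, the infimum is over all estimators $\tilde S_n$ of $S(z_0)$ (i.e. all real-valued measurable functions of the observations $(y_1,\dots,y_n)$), and $\eta$ is a Gaussian random variable with mean $0$ and variance $1/2$.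
   Context: Model: for each $n$, one observes $y_1,\dots,y_n$ with $y_k=S(x_k)y_{k-1}+\xi_k$, $1\le k\le n$, $x_k=k/n$, where the initial value $y_0$ is a fixed (nonrandom) real number, $S:[0,1]\to\mathbb R$ is unknown, and the $\xi_k$ are i.i.d. with density $p$ belonging to the class $\mathcal P_\varsigma$ of probability densities $p\ge0$ on $\mathbb R$ such that $\int x\,p(x)\,dx=0$, $\int x^2p(x)\,dx=1$ and $\sup_{k\ge1}\frac{1}{\varsigma^k(2k-1)!!}\int|x|^{2k}p(x)\,dx\le1$. $\mathbf E_{S,p}$ denotes expectation under the law of the observations corresponding to $S$ and $p$. Stability set: $\Theta_{\varepsilon,L}=\{S\in C^1([0,1],\mathbb R):\ \sup_{0\le x\le 1}|S(x)|\le1-\varepsilon,\ \sup_{0\le x\le 1}|\dot S(x)|\le L\}$. Weak stable local Hölder class at $z_0$: $\mathcal U_n^{(\beta)}(\varepsilon,L,\epsilon_n^* )=\{S\in\Theta_{\varepsilon,L}:\ |\Omega_h(z_0,S)|\le\epsilon_n^*h^\beta\}$, where $\Omega_h(z_0,S)=\int_{-1}^1\big(S(z_0+uh)-S(z_0)\big)\,du$ and $h=h_n=n^{-1/(2\beta+1)}$ ($n$ large enough that $[z_0-h,z_0+h]\subset[0,1]$). Robust risk: $\mathcal R_n(\tilde S_n,S)=\sup_{p\in\mathcal P_\varsigma}\mathbf E_{S,p}|\tilde S_n-S(z_0)|$. *)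

theory Defs
  imports "HOL-Probability.Probability"
begin

(* (2k-1)!! = 1 * 3 * ... * (2k-1) *)
definition odd_double_fact :: "nat \<Rightarrow> nat" where
  "odd_double_fact k = (\<Prod>i=1..k. 2 * i - 1)"

(* The even moments are taken in [0,\<infinity>], so that the last condition forces them to be finite. *)
definition noise_densities :: "real \<Rightarrow> (real \<Rightarrow> real) set" where
  "noise_densities varsigma = {p. p \<in> borel_measurable borel \<and> (\<forall>x. 0 \<le> p x) \<and>
     has_bochner_integral lborel p 1 \<and>
     has_bochner_integral lborel (\<lambda>x. x * p x) 0 \<and>
     has_bochner_integral lborel (\<lambda>x. x\<^sup>2 * p x) 1 \<and>
     (SUP k\<in>{1..}. (\<integral>\<^sup>+ x. ennreal (\<bar>x\<bar> ^ (2 * k) * p x) \<partial>lborel)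
                      / ennreal (varsigma ^ k * real (odd_double_fact k))) \<le> 1}"

(* The sample y_k = S(k/n) y_{k-1} + \<xi>_k as a function of the noise; the design points k/n
   depend on n. *)
primrec ar_path :: "nat \<Rightarrow> real \<Rightarrow> (real \<Rightarrow> real) \<Rightarrow> (nat \<Rightarrow> real) \<Rightarrow> nat \<Rightarrow> real" where
  "ar_path n y0 S \<xi> 0 = y0"
| "ar_path n y0 S \<xi> (Suc k) = S (real (Suc k) / real n) * ar_path n y0 S \<xi> k + \<xi> (Suc k)"

abbreviation obs_space :: "nat \<Rightarrow> (nat \<Rightarrow> real) measure" where
  "obs_space n \<equiv> Pi\<^sub>M {1..n} (\<lambda>_. borel)"

abbreviation noise_law :: "nat \<Rightarrow> (real \<Rightarrow> real) \<Rightarrow> (nat \<Rightarrow> real) measure" where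
  "noise_law n p \<equiv> Pi\<^sub>M {1..n} (\<lambda>_. density lborel p)"

definition obs_law ::
    "nat \<Rightarrow> real \<Rightarrow> (real \<Rightarrow> real) \<Rightarrow> (real \<Rightarrow> real) \<Rightarrow> (nat \<Rightarrow> real) measure" where
  "obs_law n y0 S p =
     distr (noise_law n p) (obs_space n) (\<lambda>\<xi>. \<lambda>k\<in>{1..n}. ar_path n y0 S \<xi> k)"

(* distr and density are only meaningful for measurable arguments; the next two lemmas record
   that obs_law is indeed a probability measure. *)
lemma measurable_ar_path:
  "(\<lambda>\<xi>. \<lambda>k\<in>{1..n}. ar_path n y0 S \<xi> k) \<in> measurable (noise_law n p) (obs_space n)"
proof (rule measurable_restrict)
  fix k assume "k \<in> {1..n}"
  then have "k \<le> n" by simp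
  then show "(\<lambda>\<xi>. ar_path n y0 S \<xi> k) \<in> borel_measurable (noise_law n p)"
  proof (induction k)
    case (Suc k)
    then have "(\<lambda>\<xi>. \<xi> (Suc k)) \<in> measurable (noise_law n p) (density lborel p)"
      by (intro measurable_component_singleton) auto
    then have "(\<lambda>\<xi>. \<xi> (Suc k)) \<in> borel_measurable (noise_law n p)"
      by (simp cong: measurable_cong_sets)
    with Suc show ?case by simp
  qed simp
qed

lemma prob_space_obs_law:
  assumes "p \<in> noise_densities varsigma"
  shows "prob_space (obs_law n y0 S p)"
proof -
  have p: "p \<in> borel_measurable borel" "\<And>x. 0 \<le> p x" "has_bochner_integral lborel p 1"
    using assms by (auto simp: noise_densities_def)
  then have "(\<integral>\<^sup>+ x. ennreal (p x) \<partial>lborel) = 1"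
    using nn_integral_eq_integral[of lborel p] by (auto simp: has_bochner_integral_iff)
  then interpret D: prob_space "density lborel p"
    using p by (intro prob_spaceI) (simp add: emeasure_density)
  interpret P: product_prob_space "\<lambda>_::nat. density lborel p" "{1..n}" ..
  show ?thesis
    unfolding obs_law_def by (rule P.prob_space_distr[OF measurable_ar_path])
qed

(* An S : [0,1] \<rightarrow> R is represented by a function on the whole real line whose values outside
   [0,1] are ignored; the derivative is one-sided at the end points. *)
definition stable_class :: "real \<Rightarrow> real \<Rightarrow> (real \<Rightarrow> real) set" where
  "stable_class \<epsilon> L = {S. \<exists>S'. continuous_on {0..1} S' \<and>
     (\<forall>x\<in>{0..1}. (S has_real_derivative S' x) (at x within {0..1}) \<and>
                 \<bar>S x\<bar> \<le> 1 - \<epsilon> \<and> \<bar>S' x\<bar> \<le> L)}"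

definition local_osc :: "real \<Rightarrow> real \<Rightarrow> (real \<Rightarrow> real) \<Rightarrow> real" where
  "local_osc h z0 S = integral {-1..1} (\<lambda>u. S (z0 + u * h) - S z0)"

definition bandwidth :: "real \<Rightarrow> nat \<Rightarrow> real" where
  "bandwidth \<beta> n = real n powr (- 1 / (2 * \<beta> + 1))"

(* Meaningful only for n so large that [z0 - h, z0 + h] is contained in [0,1]. Here e is the
   n-th weak Hoelder constant. *)
definition weak_hoelder_class ::
    "real \<Rightarrow> real \<Rightarrow> nat \<Rightarrow> real \<Rightarrow> real \<Rightarrow> real \<Rightarrow> (real \<Rightarrow> real) set" where
  "weak_hoelder_class z0 \<beta> n \<epsilon> L e =
     {S \<in> stable_class \<epsilon> L.
        \<bar>local_osc (bandwidth \<beta> n) z0 S\<bar> \<le> e * bandwidth \<beta> n powr \<beta>}"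

(* The risk is [0,\<infinity>]-valued: an estimator need not have a finite first moment. *)
definition robust_risk ::
    "real \<Rightarrow> real \<Rightarrow> real \<Rightarrow> nat \<Rightarrow> ((nat \<Rightarrow> real) \<Rightarrow> real) \<Rightarrow> (real \<Rightarrow> real) \<Rightarrow> ennreal" where
  "robust_risk varsigma y0 z0 n T S =
     (SUP p\<in>noise_densities varsigma. \<integral>\<^sup>+ y. ennreal \<bar>T y - S z0\<bar> \<partial>obs_law n y0 S p)"

definition stationary_factor :: "real \<Rightarrow> (real \<Rightarrow> real) \<Rightarrow> real" where
  "stationary_factor z0 S = 1 - (S z0)\<^sup>2"

definition rate :: "real \<Rightarrow> nat \<Rightarrow> real" where
  "rate \<beta> n = real n powr (\<beta> / (2 * \<beta> + 1))"

end

(* The supremum is bounded below by a Bayes risk under standard normal noise. Let V be a C^1 bump that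
   equals 1 on [-1,1] and vanishes outside [-1-nu,1+nu], and let S_u(x) = (u / phi_n) V((x - z0) / h)
   with |u| <= b; the local oscillation of S_u vanishes exactly. The likelihood ratio of S_u to S = 0 is
   exp (u D - u^2 I / 2) with D linear in the products y_(k-1) y_k and I = sum of (V_k y_(k-1) / phi_n)^2,
   so for the uniform prior on [-b,b] the posterior of u is exactly a truncated normal distribution with
   mean D / I and variance 1 / I, and no central limit theorem is needed. If D / I is at distance at
   least r from the ends of [-b,b], the posterior absolute risk of every estimator is at least
   sqrt (2 / (pi I)) - 1 / r. This happens with high probability: E_u exp (l (D - u I) - l^2 I / 2) = 1
   controls D - u I, and I stays close to its value for S = 0, a weighted sum of squares of the noise
   with total weight between 2 - o(1) and 2 + 2 nu + o(1). Let n, r and 1 / nu tend to infinity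
   (in this order), with b = r^2; the bound becomes sqrt (2 / (2 pi)) = E |eta|. *)
theory Submission
  imports Defs "HOL-Real_Asymp.Real_Asymp"
begin

section \<open>Absolute risk in a conditionally Gaussian shift family\<close>

text \<open>The window is symmetric about the mean, so the integral for the offset
  \<open>a = t - m\<close> equals the one for \<open>- a\<close>. As |a - v| + |a + v| >= 2 |v|, no
  \<open>t\<close> does better than \<open>m\<close>; cutting the absolute moment
  \<open>s * sqrt (2 / pi)\<close> off at distance \<open>r\<close> costs at most
  \<open>s\<^sup>2 / r\<close>.\<close>

lemma normal_density_truncated_abs_moment_ge:
  fixes m r s t :: real
  assumes "0 < s" "0 < r"
  shows "ennreal (s * sqrt (2 / pi) - s\<^sup>2 / r)
    \<le> (\<integral>\<^sup>+ u. ennreal (\<bar>t - u\<bar> * normal_density m s u) * indicator {m - r..m + r} u \<partial>lborel)"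
proof -
  define N where "N = normal_density 0 s"
  define X where "X a = (\<integral>\<^sup>+ v. ennreal (\<bar>a - v\<bar> * N v) * indicator {-r..r} v \<partial>lborel)" for a
  have [measurable]: "N \<in> borel_measurable borel" by (simp add: N_def)
  have N0: "0 \<le> N v" for v by (simp add: N_def)
  have Ne: "N (- v) = N v" for v by (simp add: N_def normal_density_def)
  have shift: "(\<integral>\<^sup>+ u. ennreal (\<bar>t - u\<bar> * normal_density m s u) * indicator {m - r..m + r} u \<partial>lborel) = X (t - m)"
    unfolding X_def
    by (subst nn_integral_real_affine[where t=m and c=1])
       (auto intro!: nn_integral_cong simp: N_def normal_density_def indicator_def algebra_simps)
  have refl: "X a = (\<integral>\<^sup>+ v. ennreal (\<bar>a + v\<bar> * N v) * indicator {-r..r} v \<partial>lborel)" for a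
    unfolding X_def
    by (subst nn_integral_real_affine[where t=0 and c="-1"])
       (auto intro!: nn_integral_cong simp: Ne indicator_def)
  \<comment> \<open>This integrand is a minorant of the truncated one: for |v| >= r it is
    nonpositive, because then |v| <= v^2 / r.\<close>
  have "has_bochner_integral lborel (\<lambda>v. N v * \<bar>v\<bar> - N v * v\<^sup>2 / r) (s * sqrt (2 / pi) - s\<^sup>2 / r)"
    using normal_moment_abs_odd[OF assms(1), of 0 0] normal_moment_even[OF assms(1), of 0 1] assms
    by (intro has_bochner_integral_diff has_bochner_integral_divide_zero) (auto simp: N_def)
  then have I: "integrable lborel (\<lambda>v. N v * \<bar>v\<bar> - N v * v\<^sup>2 / r)"
      "(\<integral>v. N v * \<bar>v\<bar> - N v * v\<^sup>2 / r \<partial>lborel) = s * sqrt (2 / pi) - s\<^sup>2 / r"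
    by (auto simp: has_bochner_integral_iff)
  have "ennreal (s * sqrt (2 / pi) - s\<^sup>2 / r)
      \<le> ennreal (\<integral>v. max 0 (N v * \<bar>v\<bar> - N v * v\<^sup>2 / r) \<partial>lborel)"
    unfolding I(2)[symmetric] using I(1) by (intro ennreal_leI integral_mono) auto
  also have "\<dots> = (\<integral>\<^sup>+ v. ennreal (max 0 (N v * \<bar>v\<bar> - N v * v\<^sup>2 / r)) \<partial>lborel)"
    using I(1) by (intro nn_integral_eq_integral[symmetric]) auto
  also have "\<dots> \<le> (\<integral>\<^sup>+ v. ennreal (\<bar>v\<bar> * N v) * indicator {-r..r} v \<partial>lborel)"
  proof (intro nn_integral_mono)
    fix v
    show "ennreal (max 0 (N v * \<bar>v\<bar> - N v * v\<^sup>2 / r)) \<le> ennreal (\<bar>v\<bar> * N v) * indicator {-r..r} v"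
    proof (cases "v \<in> {-r..r}")
      case True
      then show ?thesis using N0[of v] assms by (auto intro!: ennreal_leI simp: mult.commute)
    next
      case False
      then have "r \<le> \<bar>v\<bar>" by auto
      then have "r * \<bar>v\<bar> \<le> v\<^sup>2"
        by (metis abs_ge_zero abs_mult_self_eq mult_right_mono power2_eq_square)
      then have "\<bar>v\<bar> \<le> v\<^sup>2 / r" using assms by (simp add: field_simps)
      then have "N v * \<bar>v\<bar> \<le> N v * (v\<^sup>2 / r)" using N0 by (intro mult_left_mono)
      then have "max 0 (N v * \<bar>v\<bar> - N v * v\<^sup>2 / r) = 0" by (simp add: max_def)
      then show ?thesis by simp
    qed
  qed
  finally have A: "ennreal (s * sqrt (2 / pi) - s\<^sup>2 / r)
      \<le> (\<integral>\<^sup>+ v. ennreal (\<bar>v\<bar> * N v) * indicator {-r..r} v \<partial>lborel)" .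
  have "2 * (\<integral>\<^sup>+ v. ennreal (\<bar>v\<bar> * N v) * indicator {-r..r} v \<partial>lborel)
      = (\<integral>\<^sup>+ v. 2 * (ennreal (\<bar>v\<bar> * N v) * indicator {-r..r} v) \<partial>lborel)"
    by (subst nn_integral_cmult) auto
  also have "\<dots> \<le> (\<integral>\<^sup>+ v. ennreal (\<bar>(t - m) - v\<bar> * N v) * indicator {-r..r} v
        + ennreal (\<bar>(t - m) + v\<bar> * N v) * indicator {-r..r} v \<partial>lborel)"
  proof (intro nn_integral_mono)
    fix v
    have "2 * (\<bar>v\<bar> * N v) \<le> (\<bar>(t - m) - v\<bar> + \<bar>(t - m) + v\<bar>) * N v"
      using N0[of v] by (subst mult.assoc[symmetric], intro mult_right_mono) auto
    then have "ennreal (2 * (\<bar>v\<bar> * N v)) \<le> ennreal (\<bar>(t - m) - v\<bar> * N v) + ennreal (\<bar>(t - m) + v\<bar> * N v)"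
      using N0[of v] by (metis abs_ge_zero distrib_right ennreal_leI ennreal_plus mult_nonneg_nonneg)
    then show "2 * (ennreal (\<bar>v\<bar> * N v) * indicator {-r..r} v) \<le> ennreal (\<bar>(t - m) - v\<bar> * N v) * indicator {-r..r} v
        + ennreal (\<bar>(t - m) + v\<bar> * N v) * indicator {-r..r} v"
      by (auto split: split_indicator simp: ennreal_mult' N0)
  qed
  also have "\<dots> = X (t - m) + X (t - m)"
    by (subst nn_integral_add) (auto simp: refl[of "t - m", symmetric] X_def[of "t - m", symmetric])
  also have "\<dots> = 2 * X (t - m)" by (simp add: mult_2)
  finally have "(\<integral>\<^sup>+ v. ennreal (\<bar>v\<bar> * N v) * indicator {-r..r} v \<partial>lborel) \<le> X (t - m)"
    by (subst (asm) ennreal_mult_le_mult_iff) auto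
  with A show ?thesis unfolding shift by (rule order_trans)
qed

text \<open>Completing the square in \<open>u\<close>. The factor in front of the normal density
  does not involve \<open>u\<close>, so it scales the posterior risk and its normalising integral
  alike.\<close>

lemma exp_quadratic_eq_normal_density:
  fixes D I u :: real
  assumes "0 < I"
  shows "exp (u * D - u\<^sup>2 * I / 2)
    = (exp (D\<^sup>2 / (2 * I)) * sqrt (2 * pi / I)) * normal_density (D / I) (1 / sqrt I) u"
proof -
  have "u * D - u\<^sup>2 * I / 2 = D\<^sup>2 / (2 * I) + (- (u - D / I)\<^sup>2 / (2 * (1 / sqrt I)\<^sup>2))"
    using assms by (simp add: field_simps power2_eq_square)
  moreover have "sqrt (2 * pi / I) * (1 / sqrt (2 * pi * (1 / sqrt I)\<^sup>2)) = 1"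
    using assms by (simp add: real_sqrt_divide real_sqrt_mult power_divide)
  ultimately show ?thesis
    by (simp add: normal_density_def exp_add[symmetric] mult_ac)
qed

(* Given D and I the posterior of u under a flat prior is normal with mean D / I and variance 1 / I. *)
lemma posterior_abs_risk_ge:
  fixes D I J b r t :: real
  assumes "1 \<le> I" "I \<le> J" "0 < r" "\<bar>D\<bar> \<le> (b - r) * I"
  shows "ennreal (sqrt (2 / (pi * J)) - 1 / r)
      * (\<integral>\<^sup>+ u. ennreal (exp (u * D - u\<^sup>2 * I / 2)) * indicator {-b..b} u \<partial>lborel)
    \<le> (\<integral>\<^sup>+ u. ennreal (\<bar>t - u\<bar> * exp (u * D - u\<^sup>2 * I / 2)) * indicator {-b..b} u \<partial>lborel)"
proof -
  define K where "K = exp (D\<^sup>2 / (2 * I)) * sqrt (2 * pi / I)"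
  define m where "m = D / I"
  define s where "s = 1 / sqrt I"
  have I: "0 < I" using assms by simp
  have K0: "0 \<le> K" using I by (simp add: K_def)
  have s0: "0 < s" using I by (simp add: s_def)
  have q: "exp (u * D - u\<^sup>2 * I / 2) = K * normal_density m s u" for u
    unfolding K_def m_def s_def using exp_quadratic_eq_normal_density[OF I] by simp
  \<comment> \<open>The bound on \<open>D\<close> puts the posterior mean at distance at least
    \<open>r\<close> from both ends of the prior interval, so the window around it fits
    inside.\<close>
  have "\<bar>m\<bar> \<le> b - r" using assms I by (simp add: m_def abs_divide field_simps)
  then have sub: "{m - r..m + r} \<subseteq> {-b..b}" by auto
  have "s\<^sup>2 \<le> 1" using assms I by (simp add: s_def power_divide)
  then have "s\<^sup>2 / r \<le> 1 / r" using assms by (intro divide_right_mono) auto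
  moreover have "sqrt (2 / (pi * J)) \<le> s * sqrt (2 / pi)"
    using assms I by (simp add: s_def real_sqrt_mult[symmetric] real_sqrt_divide[symmetric] frac_le)
  ultimately have "ennreal (sqrt (2 / (pi * J)) - 1 / r) \<le> ennreal (s * sqrt (2 / pi) - s\<^sup>2 / r)"
    by (intro ennreal_leI) auto
  also note normal_density_truncated_abs_moment_ge[OF s0 \<open>0 < r\<close>, of t m]
  also have "(\<integral>\<^sup>+ u. ennreal (\<bar>t - u\<bar> * normal_density m s u) * indicator {m - r..m + r} u \<partial>lborel)
      \<le> (\<integral>\<^sup>+ u. ennreal (\<bar>t - u\<bar> * normal_density m s u) * indicator {-b..b} u \<partial>lborel)"
    using sub by (intro nn_integral_mono) (auto split: split_indicator)
  finally have 1: "ennreal (sqrt (2 / (pi * J)) - 1 / r)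
    \<le> (\<integral>\<^sup>+ u. ennreal (\<bar>t - u\<bar> * normal_density m s u) * indicator {-b..b} u \<partial>lborel)" .
  \<comment> \<open>The normalising integral over [-b,b] is at most \<open>K\<close>, its value over
    the whole line.\<close>
  have "(\<integral>\<^sup>+ u. ennreal (exp (u * D - u\<^sup>2 * I / 2)) * indicator {-b..b} u \<partial>lborel)
      \<le> (\<integral>\<^sup>+ u. ennreal K * ennreal (normal_density m s u) \<partial>lborel)"
    by (intro nn_integral_mono) (auto simp: q ennreal_mult K0 split: split_indicator)
  also have "\<dots> = ennreal K"
    using s0 prob_space.emeasure_space_1[OF prob_space_normal_density[of s m]]
    by (subst nn_integral_cmult) (auto simp: emeasure_density)
  finally have "ennreal (sqrt (2 / (pi * J)) - 1 / r)
      * (\<integral>\<^sup>+ u. ennreal (exp (u * D - u\<^sup>2 * I / 2)) * indicator {-b..b} u \<partial>lborel)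
    \<le> (\<integral>\<^sup>+ u. ennreal (\<bar>t - u\<bar> * normal_density m s u) * indicator {-b..b} u \<partial>lborel) * ennreal K"
    using 1 by (intro mult_mono) auto
  also have "\<dots> = (\<integral>\<^sup>+ u. ennreal (\<bar>t - u\<bar> * exp (u * D - u\<^sup>2 * I / 2)) * indicator {-b..b} u \<partial>lborel)"
    unfolding q by (subst nn_integral_multc[symmetric])
      (auto intro!: nn_integral_cong simp: ennreal_mult[symmetric] K0 mult_ac split: split_indicator)
  finally show ?thesis .
qed

text \<open>Average the risk over \<open>u\<close> uniform on [-b,b], interchange the integrals, and
  apply the posterior bound for each sample in the event \<open>G\<close>. For |u| <= b - 2r this
  event has probability at least \<open>1 - \<delta> - 2 * exp (J / 2 - r)\<close> under the
  parameter \<open>u\<close>; the factor \<open>1 - 2 * r / b\<close> is the prior mass of these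
  \<open>u\<close>.\<close>

lemma conditionally_gaussian_minimax_abs_risk:
  fixes D I T :: "'b \<Rightarrow> real" and b r J \<delta> :: real and R :: ennreal
  assumes P: "prob_space P"
    and [measurable]: "D \<in> borel_measurable P" "I \<in> borel_measurable P" "T \<in> borel_measurable P"
    and lik: "\<And>u. (\<integral>\<^sup>+ y. ennreal (exp (u * D y - u\<^sup>2 * I y / 2)) \<partial>P) = 1"
    and r: "0 < r" "2 * r < b"
    and J: "1 / r \<le> sqrt (2 / (pi * J))"
    and \<delta>: "0 \<le> \<delta>" "\<delta> + 2 * exp (J / 2 - r) \<le> 1"
    and conc: "\<And>u. \<bar>u\<bar> \<le> b \<Longrightarrow> ennreal (1 - \<delta>) \<le>
      (\<integral>\<^sup>+ y. ennreal (exp (u * D y - u\<^sup>2 * I y / 2)) * indicator {y. 1 \<le> I y \<and> I y \<le> J} y \<partial>P)"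
    and risk: "\<And>u. \<bar>u\<bar> \<le> b \<Longrightarrow> (\<integral>\<^sup>+ y. ennreal (\<bar>T y - u\<bar> * exp (u * D y - u\<^sup>2 * I y / 2)) \<partial>P) \<le> R"
  shows "ennreal ((sqrt (2 / (pi * J)) - 1 / r) * (1 - 2 * r / b) * (1 - \<delta> - 2 * exp (J / 2 - r))) \<le> R"
proof -
  interpret prob_space P by fact
  interpret L: pair_sigma_finite P lborel ..
  define q where "q u y = exp (u * D y - u\<^sup>2 * I y / 2)" for u y
  define G where "G = {y. 1 \<le> I y \<and> I y \<le> J \<and> \<bar>D y\<bar> \<le> (b - r) * I y}"
  define \<kappa> where "\<kappa> = sqrt (2 / (pi * J)) - 1 / r"
  define \<rho> where "\<rho> = 1 - \<delta> - 2 * exp (J / 2 - r)"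
  have q0: "0 \<le> q u y" for u y by (simp add: q_def)
  have \<kappa>0: "0 \<le> \<kappa>" and \<rho>0: "0 \<le> \<rho>" using J \<delta> by (auto simp: \<kappa>_def \<rho>_def)
  have [measurable]: "Measurable.pred P (\<lambda>y. y \<in> G)" unfolding G_def by simp
  have [measurable]: "Measurable.pred (P \<Otimes>\<^sub>M lborel) (\<lambda>x. fst x \<in> G)" unfolding G_def by simp
  have [measurable]: "q u \<in> borel_measurable P" for u unfolding q_def by measurable
  have [measurable]: "(\<lambda>x. q (snd x) (fst x)) \<in> borel_measurable (P \<Otimes>\<^sub>M lborel)"
    unfolding q_def by measurable
  have b: "0 < b" using r by simp
  (* Chernoff bound: for l = 1 or l = -1 the ratio of the likelihoods at u + l and u is
     exp (l (D - u I) - I / 2). *)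
  have tail: "(\<integral>\<^sup>+ y. ennreal (q u y) * indicator {y. I y \<le> J \<and> r < l * (D y - u * I y)} y \<partial>P)
      \<le> ennreal (exp (J / 2 - r))" if "l\<^sup>2 = 1" for u l :: real
  proof -
    have "(\<integral>\<^sup>+ y. ennreal (q u y) * indicator {y. I y \<le> J \<and> r < l * (D y - u * I y)} y \<partial>P)
       \<le> (\<integral>\<^sup>+ y. ennreal (exp (J / 2 - r)) * ennreal (q (u + l) y) \<partial>P)"
    proof (intro nn_integral_mono)
      fix y
      have "q u y \<le> exp (J / 2 - r) * q (u + l) y" if "I y \<le> J" "r < l * (D y - u * I y)"
      proof -
        have "(u + l)\<^sup>2 = u\<^sup>2 + 2 * u * l + 1" using \<open>l\<^sup>2 = 1\<close> by (simp add: power2_sum)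
        then have "u * D y - u\<^sup>2 * I y / 2 \<le> (J / 2 - r) + ((u + l) * D y - (u + l)\<^sup>2 * I y / 2)"
        proof -
          have "(J / 2 - r) + ((u + l) * D y - (u + l)\<^sup>2 * I y / 2) - (u * D y - u\<^sup>2 * I y / 2)
              = (J - I y) / 2 + (l * (D y - u * I y) - r)"
            unfolding \<open>(u + l)\<^sup>2 = u\<^sup>2 + 2 * u * l + 1\<close> by (simp add: field_simps)
          moreover have "0 \<le> (J - I y) / 2 + (l * (D y - u * I y) - r)" using that by simp
          ultimately show ?thesis by (metis diff_ge_0_iff_ge)
        qed
        then show ?thesis by (simp add: q_def exp_add[symmetric])
      qed
      then show "ennreal (q u y) * indicator {y. I y \<le> J \<and> r < l * (D y - u * I y)} y
          \<le> ennreal (exp (J / 2 - r)) * ennreal (q (u + l) y)"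
        by (auto simp: ennreal_mult[symmetric] q0 intro!: ennreal_leI split: split_indicator)
    qed
    also have "\<dots> = ennreal (exp (J / 2 - r))"
      using lik[of "u + l"] by (subst nn_integral_cmult) (auto simp: q_def)
    finally show ?thesis .
  qed
  \<comment> \<open>If |D - u I| <= r, then |D| <= (b - 2r) I + r <= (b - r) I because I >= 1. So on
    the information event, leaving \<open>G\<close> forces one of the two tail events.\<close>
  have mass: "ennreal \<rho> \<le> (\<integral>\<^sup>+ y. ennreal (q u y) * indicator G y \<partial>P)" if u: "\<bar>u\<bar> \<le> b - 2 * r" for u
  proof -
    let ?A = "\<lambda>l. {y. I y \<le> J \<and> r < l * (D y - u * I y)}"
    have "ennreal (1 - \<delta>) \<le> (\<integral>\<^sup>+ y. ennreal (q u y) * indicator {y. 1 \<le> I y \<and> I y \<le> J} y \<partial>P)"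
      using conc[of u] u r unfolding q_def by auto
    also have "\<dots> \<le> (\<integral>\<^sup>+ y. ennreal (q u y) * indicator G y + (ennreal (q u y) * indicator (?A 1) y
        + ennreal (q u y) * indicator (?A (-1)) y) \<partial>P)"
    proof (intro nn_integral_mono)
      fix y
      have "y \<in> G \<union> ?A 1 \<union> ?A (-1)" if "1 \<le> I y" "I y \<le> J"
      proof (rule ccontr)
        assume "y \<notin> G \<union> ?A 1 \<union> ?A (-1)"
        with that have *: "\<bar>D y - u * I y\<bar> \<le> r" "(b - r) * I y < \<bar>D y\<bar>" by (auto simp: G_def)
        have "\<bar>D y\<bar> \<le> \<bar>u * I y\<bar> + r" using *(1) by linarith
        also have "\<dots> \<le> (b - 2 * r) * I y + r * I y"
          using u that r by (intro add_mono) (auto simp: abs_mult intro!: mult_mono)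
        also have "\<dots> = (b - r) * I y" by (simp add: algebra_simps)
        finally show False using *(2) by simp
      qed
      then show "ennreal (q u y) * indicator {y. 1 \<le> I y \<and> I y \<le> J} y
        \<le> ennreal (q u y) * indicator G y + (ennreal (q u y) * indicator (?A 1) y
          + ennreal (q u y) * indicator (?A (-1)) y)"
        by (auto split: split_indicator)
    qed
    also have "\<dots> = (\<integral>\<^sup>+ y. ennreal (q u y) * indicator G y \<partial>P)
        + ((\<integral>\<^sup>+ y. ennreal (q u y) * indicator (?A 1) y \<partial>P)
          + (\<integral>\<^sup>+ y. ennreal (q u y) * indicator (?A (-1)) y \<partial>P))"
      by (simp add: nn_integral_add)
    also have "\<dots> \<le> (\<integral>\<^sup>+ y. ennreal (q u y) * indicator G y \<partial>P)
        + (ennreal (exp (J / 2 - r)) + ennreal (exp (J / 2 - r)))"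
      by (intro add_mono order_refl tail) auto
    also have "ennreal (exp (J / 2 - r)) + ennreal (exp (J / 2 - r)) = ennreal (2 * exp (J / 2 - r))"
      by (subst ennreal_plus[symmetric]) auto
    finally have "ennreal (1 - \<delta>) \<le> (\<integral>\<^sup>+ y. ennreal (q u y) * indicator G y \<partial>P) + ennreal (2 * exp (J / 2 - r))" .
    moreover have "ennreal \<rho> = ennreal (1 - \<delta>) - ennreal (2 * exp (J / 2 - r))"
      unfolding \<rho>_def by (simp add: ennreal_minus)
    ultimately show ?thesis
      by (simp add: ennreal_minus_le_iff add.commute)
  qed
  \<comment> \<open>Only the inner \<open>u\<close> with |u| <= b - 2r are counted here, which gives
    the length \<open>2 * (b - 2 * r)\<close>.\<close>
  have "ennreal \<kappa> * (ennreal \<rho> * ennreal (2 * (b - 2 * r)))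
      = ennreal \<kappa> * (\<integral>\<^sup>+ u. ennreal \<rho> * indicator {-(b - 2 * r)..b - 2 * r} u \<partial>lborel)"
    using r by (subst nn_integral_cmult_indicator) auto
  also have "\<dots> \<le> ennreal \<kappa> * (\<integral>\<^sup>+ u. (\<integral>\<^sup>+ y. ennreal (q u y) * indicator G y * indicator {-b..b} u \<partial>P) \<partial>lborel)"
  proof (intro mult_left_mono nn_integral_mono)
    fix u
    show "ennreal \<rho> * indicator {-(b - 2 * r)..b - 2 * r} u
        \<le> (\<integral>\<^sup>+ y. ennreal (q u y) * indicator G y * indicator {-b..b} u \<partial>P)"
      using mass[of u] r by (auto split: split_indicator)
  qed auto
  also have "(\<integral>\<^sup>+ u. (\<integral>\<^sup>+ y. ennreal (q u y) * indicator G y * indicator {-b..b} u \<partial>P) \<partial>lborel)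
      = (\<integral>\<^sup>+ y. (\<integral>\<^sup>+ u. ennreal (q u y) * indicator G y * indicator {-b..b} u \<partial>lborel) \<partial>P)"
    by (rule L.Fubini') (simp add: split_def)
  also have "ennreal \<kappa> * (\<integral>\<^sup>+ y. (\<integral>\<^sup>+ u. ennreal (q u y) * indicator G y * indicator {-b..b} u \<partial>lborel) \<partial>P)
      = (\<integral>\<^sup>+ y. ennreal \<kappa> * (\<integral>\<^sup>+ u. ennreal (q u y) * indicator G y * indicator {-b..b} u \<partial>lborel) \<partial>P)"
    by (rule nn_integral_cmult[symmetric]) measurable
  \<comment> \<open>Samples outside \<open>G\<close> contribute 0 on the left; on \<open>G\<close>
    this is the posterior bound at \<open>t = T y\<close>.\<close>
  also have "\<dots> \<le> (\<integral>\<^sup>+ y. (\<integral>\<^sup>+ u. ennreal (\<bar>T y - u\<bar> * q u y) * indicator {-b..b} u \<partial>lborel) \<partial>P)"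
  proof (intro nn_integral_mono)
    fix y
    show "ennreal \<kappa> * (\<integral>\<^sup>+ u. ennreal (q u y) * indicator G y * indicator {-b..b} u \<partial>lborel)
      \<le> (\<integral>\<^sup>+ u. ennreal (\<bar>T y - u\<bar> * q u y) * indicator {-b..b} u \<partial>lborel)"
      using posterior_abs_risk_ge[of "I y" J r "D y" b "T y"] r
      by (cases "y \<in> G") (auto simp: G_def \<kappa>_def q_def)
  qed
  also have "\<dots> = (\<integral>\<^sup>+ u. (\<integral>\<^sup>+ y. ennreal (\<bar>T y - u\<bar> * q u y) * indicator {-b..b} u \<partial>P) \<partial>lborel)"
    by (rule L.Fubini'[symmetric]) (simp add: split_def)
  also have "\<dots> \<le> (\<integral>\<^sup>+ u. R * indicator {-b..b} u \<partial>lborel)"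
  proof (intro nn_integral_mono)
    fix u
    show "(\<integral>\<^sup>+ y. ennreal (\<bar>T y - u\<bar> * q u y) * indicator {-b..b} u \<partial>P) \<le> R * indicator {-b..b} u"
      using risk[of u] by (auto split: split_indicator simp: q_def)
  qed
  also have "\<dots> = R * ennreal (2 * b)"
    using b by (subst nn_integral_cmult_indicator) auto
  finally have "ennreal (\<kappa> * (\<rho> * (2 * (b - 2 * r)))) \<le> R * ennreal (2 * b)"
    using \<kappa>0 \<rho>0 r by (simp add: ennreal_mult[symmetric])
  then have "ennreal (1 / (2 * b)) * ennreal (\<kappa> * (\<rho> * (2 * (b - 2 * r)))) \<le> ennreal (1 / (2 * b)) * (R * ennreal (2 * b))"
    by (intro mult_left_mono) auto
  also have "\<dots> = R * (ennreal (1 / (2 * b)) * ennreal (2 * b))" by (simp add: mult_ac)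
  also have "ennreal (1 / (2 * b)) * ennreal (2 * b) = 1"
    using b by (simp add: ennreal_mult[symmetric])
  also have "ennreal (1 / (2 * b)) * ennreal (\<kappa> * (\<rho> * (2 * (b - 2 * r)))) = ennreal (\<kappa> * (1 - 2 * r / b) * \<rho>)"
  proof -
    have "1 / (2 * b) * (\<kappa> * (\<rho> * (2 * (b - 2 * r)))) = \<kappa> * (1 - 2 * r / b) * \<rho>"
      using b by (simp add: field_simps)
    then show ?thesis using b \<kappa>0 \<rho>0 r by (subst ennreal_mult[symmetric]) simp_all
  qed
  finally show ?thesis by (simp add: \<kappa>_def \<rho>_def)
qed

section \<open>The autoregression with standard normal noise\<close>

lemma sets_noise_law [measurable_cong]: "sets (noise_law n p) = sets (obs_space n)"
  by (rule sets_PiM_cong) auto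

lemma prob_space_std_normal: "prob_space (density lborel std_normal_density)"
  by (simp add: prob_space_normal_density)

text \<open>One-dimensional Cameron-Martin formula: expanding the square in the shifted density
  gives the exponential weight. It supplies the factor that one observation contributes to the
  likelihood.\<close>

lemma nn_integral_std_normal_translate:
  fixes s :: real
  assumes [measurable]: "f \<in> borel_measurable borel"
  shows "(\<integral>\<^sup>+ t. f (s + t) \<partial>density lborel std_normal_density)
    = (\<integral>\<^sup>+ t. f t * ennreal (exp (s * t - s\<^sup>2 / 2)) \<partial>density lborel std_normal_density)"
proof -
  have e: "std_normal_density (t - s) = std_normal_density t * exp (s * t - s\<^sup>2 / 2)" for t
    by (simp add: std_normal_density_def exp_add[symmetric] power2_diff field_simps)
  have "(\<integral>\<^sup>+ t. f (s + t) \<partial>density lborel std_normal_density)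
      = (\<integral>\<^sup>+ t. ennreal (std_normal_density ((s + t) - s)) * f (s + t) \<partial>lborel)"
    by (simp add: nn_integral_density)
  also have "\<dots> = (\<integral>\<^sup>+ t. ennreal (std_normal_density (t - s)) * f t \<partial>lborel)"
    by (subst nn_integral_real_affine[where t=s and c=1 and f="\<lambda>t. ennreal (std_normal_density (t - s)) * f t"]) auto
  also have "\<dots> = (\<integral>\<^sup>+ t. f t * ennreal (exp (s * t - s\<^sup>2 / 2)) \<partial>density lborel std_normal_density)"
    by (simp add: nn_integral_density e ennreal_mult mult_ac)
  finally show ?thesis .
qed

lemma ar_path_fun_upd_eq:
  "k < i \<Longrightarrow> ar_path n y0 S (\<xi>(i := t)) k = ar_path n y0 S \<xi> k"
  by (induction k) auto

text \<open>The sample length \<open>m\<close> is kept apart from the \<open>n\<close> of the design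
  points \<open>k / n\<close>, so that an induction on the length leaves the design fixed.\<close>

lemma measurable_ar_path_prefix:
  "(\<lambda>\<xi>. \<lambda>k\<in>{1..m}. ar_path n y0 S \<xi> k) \<in> measurable (noise_law m p) (obs_space m)"
proof (rule measurable_restrict)
  fix k assume "k \<in> {1..m}"
  then have "k \<le> m" by simp
  then show "(\<lambda>\<xi>. ar_path n y0 S \<xi> k) \<in> borel_measurable (noise_law m p)"
  proof (induction k)
    case (Suc k)
    then have "(\<lambda>\<xi>. \<xi> (Suc k)) \<in> borel_measurable (obs_space m)"
      by (intro measurable_component_singleton) auto
    then have "(\<lambda>\<xi>. \<xi> (Suc k)) \<in> borel_measurable (noise_law m p)"
      by (simp cong: measurable_cong_sets)
    with Suc show ?case by simp
  qed simp
qed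

(* y(0 := y0) prepends the initial value to a sample indexed by 1..m. *)
definition ar_log_likelihood ::
    "nat \<Rightarrow> real \<Rightarrow> (real \<Rightarrow> real) \<Rightarrow> nat \<Rightarrow> (nat \<Rightarrow> real) \<Rightarrow> real" where
  "ar_log_likelihood n y0 S m y = (\<Sum>k=1..m. S (real k / real n) * (y(0 := y0)) (k - 1) * y k
     - (S (real k / real n) * (y(0 := y0)) (k - 1))\<^sup>2 / 2)"

lemma measurable_lag [measurable]:
  assumes "k \<in> {1..m}"
  shows "(\<lambda>y. (y(0 := y0 :: real)) (k - 1)) \<in> borel_measurable (obs_space m)"
proof (cases "k = 1")
  case False
  then have "(\<lambda>y :: nat \<Rightarrow> real. y (k - 1)) \<in> borel_measurable (obs_space m)"
    using assms by (intro measurable_component_singleton) auto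
  with False assms show ?thesis by (simp add: fun_upd_def)
qed simp

lemma measurable_ar_log_likelihood [measurable]:
  "ar_log_likelihood n y0 S m \<in> borel_measurable (obs_space m)"
  unfolding ar_log_likelihood_def
  by (intro borel_measurable_sum borel_measurable_diff borel_measurable_times borel_measurable_divide
      borel_measurable_power borel_measurable_const measurable_lag measurable_component_singleton) auto

text \<open>For S = 0 the path is the noise itself, so the noise law is also the reference law of
  the sample, and the weight is the likelihood ratio of \<open>S\<close> to 0. Induction on the
  length: given the first \<open>m\<close> values, the next one is a translated standard normal, and
  the Cameron-Martin formula removes the translation.\<close>

lemma nn_integral_ar_path_std_normal:
  assumes "F \<in> borel_measurable (obs_space m)"
  shows "(\<integral>\<^sup>+ \<xi>. F (\<lambda>k\<in>{1..m}. ar_path n y0 S \<xi> k) \<partial>noise_law m std_normal_density)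
    = (\<integral>\<^sup>+ y. F y * ennreal (exp (ar_log_likelihood n y0 S m y)) \<partial>noise_law m std_normal_density)"
  using assms
proof (induction m arbitrary: F)
  case 0
  then show ?case by (simp add: PiM_empty nn_integral_count_space_finite ar_log_likelihood_def restrict_def)
next
  case (Suc m)
  note [measurable] = Suc.prems
  let ?N = "density lborel std_normal_density"
  interpret N: prob_space ?N by (rule prob_space_std_normal)
  interpret product_sigma_finite "\<lambda>_ :: nat. ?N" ..
  have ins: "{1..Suc m} = insert (Suc m) {1..m}" by auto
  \<comment> \<open>Conditional mean of the next observation; taking the lag from
    \<open>y(0 := y0)\<close> covers \<open>m = 0\<close> as well.\<close>
  define s where "s y = S (real (Suc m) / real n) * (y(0 := y0)) m" for y :: "nat \<Rightarrow> real"
  have [measurable]: "s \<in> borel_measurable (obs_space m)"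
  proof (cases "m = 0")
    case False
    then show ?thesis using measurable_component_singleton[of m "{1..m}" "\<lambda>_. borel"]
      by (simp add: s_def[abs_def] fun_upd_def)
  qed (simp add: s_def[abs_def])
  have upd [measurable]: "(\<lambda>(y, t). y(Suc m := t)) \<in> measurable (obs_space m \<Otimes>\<^sub>M borel) (obs_space (Suc m))"
    unfolding ins by (rule measurable_add_dim)
  \<comment> \<open>\<open>H\<close> integrates out the last observation given the first
    \<open>m\<close>. The induction hypothesis is applied to it, so \<open>F\<close> has to be
    arbitrary in the induction.\<close>
  define H where "H y = (\<integral>\<^sup>+ t. F (y(Suc m := s y + t)) \<partial>?N)" for y
  have Fm: "(\<lambda>(y, t). F (y(Suc m := s y + t))) \<in> borel_measurable (obs_space m \<Otimes>\<^sub>M borel)"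
  proof -
    have "(\<lambda>x. F ((\<lambda>(y, t). y(Suc m := t)) (fst x, s (fst x) + snd x))) \<in> borel_measurable (obs_space m \<Otimes>\<^sub>M borel)"
      by measurable
    then show ?thesis by (simp add: split_def)
  qed
  have Hm: "H \<in> borel_measurable (obs_space m)"
    unfolding H_def by (rule N.borel_measurable_nn_integral) (use Fm in \<open>simp cong: measurable_cong_sets\<close>)
  have meas1: "(\<lambda>\<xi>. F (\<lambda>k\<in>{1..Suc m}. ar_path n y0 S \<xi> k)) \<in> borel_measurable (noise_law (Suc m) std_normal_density)"
    by (rule measurable_compose[OF measurable_ar_path_prefix Suc.prems])
  have "(\<integral>\<^sup>+ \<xi>. F (\<lambda>k\<in>{1..Suc m}. ar_path n y0 S \<xi> k) \<partial>noise_law (Suc m) std_normal_density)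
     = (\<integral>\<^sup>+ \<xi>. (\<integral>\<^sup>+ t. F (\<lambda>k\<in>{1..Suc m}. ar_path n y0 S (\<xi>(Suc m := t)) k) \<partial>?N) \<partial>noise_law m std_normal_density)"
    using meas1 unfolding ins by (intro product_nn_integral_insert) auto
  also have "\<dots> = (\<integral>\<^sup>+ \<xi>. H (\<lambda>k\<in>{1..m}. ar_path n y0 S \<xi> k) \<partial>noise_law m std_normal_density)"
  proof -
    have "(\<lambda>k\<in>{1..Suc m}. ar_path n y0 S (\<xi>(Suc m := t)) k)
      = (\<lambda>k\<in>{1..m}. ar_path n y0 S \<xi> k)(Suc m := s (\<lambda>k\<in>{1..m}. ar_path n y0 S \<xi> k) + t)" for \<xi> t
      by (rule ext) (auto simp: s_def ar_path_fun_upd_eq le_Suc_eq)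
    then show ?thesis by (simp add: H_def)
  qed
  also have "\<dots> = (\<integral>\<^sup>+ y. H y * ennreal (exp (ar_log_likelihood n y0 S m y)) \<partial>noise_law m std_normal_density)"
    by (rule Suc.IH[OF Hm])
  also have "\<dots> = (\<integral>\<^sup>+ y. (\<integral>\<^sup>+ t. F (y(Suc m := t)) * ennreal (exp (ar_log_likelihood n y0 S (Suc m) (y(Suc m := t)))) \<partial>?N)
      \<partial>noise_law m std_normal_density)"
  proof (rule nn_integral_cong)
    fix y assume "y \<in> space (noise_law m std_normal_density)"
    then have y: "y \<in> space (obs_space m)" by (simp add: space_PiM)
    have [measurable]: "(\<lambda>t. F (y(Suc m := t))) \<in> borel_measurable borel"
    proof -
      have "(\<lambda>t. F ((\<lambda>(y, t). y(Suc m := t)) (y, t))) \<in> borel_measurable borel"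
        using y by measurable
      then show ?thesis by simp
    qed
    have E: "ar_log_likelihood n y0 S (Suc m) (y(Suc m := t))
        = ar_log_likelihood n y0 S m y + (s y * t - (s y)\<^sup>2 / 2)" for t
      unfolding ar_log_likelihood_def s_def ins
      by (subst sum.insert) (auto intro!: sum.cong simp: fun_upd_def)
    have Hy: "H y = (\<integral>\<^sup>+ t. F (y(Suc m := t)) * ennreal (exp (s y * t - (s y)\<^sup>2 / 2)) \<partial>?N)"
      unfolding H_def by (rule nn_integral_std_normal_translate) simp
    show "H y * ennreal (exp (ar_log_likelihood n y0 S m y))
      = (\<integral>\<^sup>+ t. F (y(Suc m := t)) * ennreal (exp (ar_log_likelihood n y0 S (Suc m) (y(Suc m := t)))) \<partial>?N)"
      unfolding Hy by (subst nn_integral_multc[symmetric]) (auto simp: E exp_add ennreal_mult mult_ac intro!: nn_integral_cong)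
  qed
  also have "\<dots> = (\<integral>\<^sup>+ y. F y * ennreal (exp (ar_log_likelihood n y0 S (Suc m) y)) \<partial>noise_law (Suc m) std_normal_density)"
  proof -
    have "(\<lambda>y. F y * ennreal (exp (ar_log_likelihood n y0 S (Suc m) y))) \<in> borel_measurable (noise_law (Suc m) std_normal_density)"
      by measurable
    then show ?thesis
      unfolding ins by (intro product_nn_integral_insert[symmetric]) auto
  qed
  finally show ?case .
qed

lemma nn_integral_obs_law_std_normal:
  assumes F [measurable]: "F \<in> borel_measurable (obs_space n)"
  shows "(\<integral>\<^sup>+ y. F y \<partial>obs_law n y0 S std_normal_density)
    = (\<integral>\<^sup>+ y. F y * ennreal (exp (ar_log_likelihood n y0 S n y)) \<partial>noise_law n std_normal_density)"
  unfolding obs_law_def nn_integral_ar_path_std_normal[OF F, symmetric]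
  by (subst nn_integral_distr[OF measurable_ar_path]) (simp_all only: measurable_distr_eq1 F)

section \<open>Second moments of weighted sums of independent variables\<close>

text \<open>The integrand is rewritten as a product over all coordinates whose factors are Z^2, Z or
  1. The integral then factorises, and for distinct \<open>i\<close> and \<open>j\<close> it
  contains the vanishing mean of \<open>Z\<close>.\<close>

lemma integral_PiM_mult_orthogonal:
  fixes D :: "'b measure" and Z :: "'b \<Rightarrow> real"
  assumes D: "prob_space D" and A: "finite A" "i \<in> A" "j \<in> A"
    and Z: "integrable D Z" "integral\<^sup>L D Z = 0" "integrable D (\<lambda>x. (Z x)\<^sup>2)"
  shows "integrable (Pi\<^sub>M A (\<lambda>_. D)) (\<lambda>x. Z (x i) * Z (x j))"
    and "(\<integral>x. Z (x i) * Z (x j) \<partial>Pi\<^sub>M A (\<lambda>_. D)) = (if i = j then \<integral>x. (Z x)\<^sup>2 \<partial>D else 0)"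
proof -
  interpret prob_space D by fact
  interpret product_sigma_finite "\<lambda>_ :: 'a. D" ..
  define f where "f k = (\<lambda>x. (if k = i then Z x else 1) * (if k = j then Z x else 1))" for k
  have "f k = (\<lambda>x. if k = i \<and> k = j then (Z x)\<^sup>2 else if k = i \<or> k = j then Z x else 1)" for k
    by (auto simp: f_def power2_eq_square)
  then have int: "integrable D (f k)"
    and val: "integral\<^sup>L D (f k) = (if k = i \<and> k = j then \<integral>x. (Z x)\<^sup>2 \<partial>D else if k = i \<or> k = j then 0 else 1)" for k
    using Z by (cases "k = i"; cases "k = j"; simp add: prob_space)+
  have eq: "(\<Prod>k\<in>A. f k (x k)) = Z (x i) * Z (x j)" for x
    using A by (simp add: f_def prod.distrib)
  show "integrable (Pi\<^sub>M A (\<lambda>_. D)) (\<lambda>x. Z (x i) * Z (x j))"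
    using product_integrable_prod[OF A(1) int, of "\<lambda>k. k"] by (simp add: eq)
  have "(\<integral>x. Z (x i) * Z (x j) \<partial>Pi\<^sub>M A (\<lambda>_. D)) = (\<Prod>k\<in>A. integral\<^sup>L D (f k))"
    using product_integral_prod[OF A(1) int, of "\<lambda>k. k"] by (simp add: eq)
  also have "\<dots> = (if i = j then \<integral>x. (Z x)\<^sup>2 \<partial>D else 0)"
  proof (cases "i = j")
    case True
    then have "(\<Prod>k\<in>A. integral\<^sup>L D (f k)) = (\<Prod>k\<in>A. if k = i then \<integral>x. (Z x)\<^sup>2 \<partial>D else 1)"
      by (intro prod.cong) (auto simp: val)
    with True A show ?thesis by simp
  next
    case False
    then show ?thesis using A by (auto intro!: bexI[of _ i] simp: prod_zero_iff val)
  qed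
  finally show "(\<integral>x. Z (x i) * Z (x j) \<partial>Pi\<^sub>M A (\<lambda>_. D)) = (if i = j then \<integral>x. (Z x)\<^sup>2 \<partial>D else 0)" .
qed

text \<open>Chebyshev's inequality; after expanding the square, orthogonality leaves only the
  diagonal terms.\<close>

lemma prob_weighted_iid_sum_ge:
  fixes D :: "'b measure" and Z :: "'b \<Rightarrow> real" and c :: "'i \<Rightarrow> real"
  assumes D: "prob_space D" and A: "finite A" and t: "0 < t"
    and Z: "integrable D Z" "integral\<^sup>L D Z = 0" "integrable D (\<lambda>x. (Z x)\<^sup>2)"
  shows "measure (Pi\<^sub>M A (\<lambda>_. D)) {x \<in> space (Pi\<^sub>M A (\<lambda>_. D)). t \<le> \<bar>\<Sum>i\<in>A. c i * Z (x i)\<bar>}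
    \<le> (\<integral>x. (Z x)\<^sup>2 \<partial>D) * (\<Sum>i\<in>A. (c i)\<^sup>2) / t\<^sup>2"
proof -
  interpret D: prob_space D by fact
  interpret P: prob_space "Pi\<^sub>M A (\<lambda>_. D)" by (rule prob_space_PiM) (rule D)
  have sq: "(\<Sum>i\<in>A. c i * Z (x i))\<^sup>2 = (\<Sum>i\<in>A. \<Sum>j\<in>A. (c i * c j) * (Z (x i) * Z (x j)))" for x
    by (simp add: power2_eq_square sum_product mult_ac)
  note orth = integral_PiM_mult_orthogonal[OF D A _ _ Z]
  have [measurable]: "Z \<in> borel_measurable D" using Z by auto
  have "integrable (Pi\<^sub>M A (\<lambda>_. D)) (\<lambda>x. (\<Sum>i\<in>A. c i * Z (x i))\<^sup>2)"
    unfolding sq by (intro Bochner_Integration.integrable_sum integrable_mult_right orth)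
  moreover have "(\<integral>x. (\<Sum>i\<in>A. c i * Z (x i))\<^sup>2 \<partial>Pi\<^sub>M A (\<lambda>_. D)) = (\<Sum>i\<in>A. \<Sum>j\<in>A. (c i * c j) * (if i = j then \<integral>x. (Z x)\<^sup>2 \<partial>D else 0))"
    unfolding sq using orth by (subst Bochner_Integration.integral_sum; (intro Bochner_Integration.integrable_sum integrable_mult_right)?)+ auto
  moreover have "\<dots> = (\<integral>x. (Z x)\<^sup>2 \<partial>D) * (\<Sum>i\<in>A. (c i)\<^sup>2)"
    by (simp add: if_distrib A sum_distrib_left power2_eq_square mult_ac cong: if_cong)
  ultimately show ?thesis
    using P.second_moment_method[of "\<lambda>x. \<Sum>i\<in>A. c i * Z (x i)" t] t by simp
qed

section \<open>The standard normal density belongs to the noise class\<close>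

text \<open>The right-hand side is the moment of order \<open>2 * k\<close> of the standard normal
  law.\<close>

lemma odd_double_fact_eq: "real (odd_double_fact k) = fact (2 * k) / (2 ^ k * fact k)"
proof (induction k)
  case (Suc k)
  have "real (odd_double_fact (Suc k)) = (2 * real k + 1) * real (odd_double_fact k)"
    by (simp add: odd_double_fact_def atLeastAtMostSuc_conv ring_distribs)
  also have "\<dots> = fact (2 * Suc k) / (2 ^ Suc k * fact (Suc k))"
  proof -
    have "fact (2 * Suc k) = (2 * (real k + 1)) * ((2 * real k + 1) * fact (2 * k))"
      by (simp add: algebra_simps)
    moreover have "2 ^ Suc k * fact (Suc k) = (2 * (real k + 1)) * (2 ^ k * fact k)"
      by (simp add: algebra_simps)
    ultimately show ?thesis
      unfolding Suc by (simp only: mult_divide_mult_cancel_left_if) simp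
  qed
  finally show ?case .
qed (simp add: odd_double_fact_def)

text \<open>The even normal moments are exactly (2k-1)!!, so the k-th ratio is varsigma^(-k), which
  is at most 1.\<close>

lemma std_normal_density_in_noise_densities:
  assumes "1 \<le> varsigma"
  shows "std_normal_density \<in> noise_densities varsigma"
proof -
  have "(\<integral>\<^sup>+ x. ennreal (\<bar>x\<bar> ^ (2 * k) * std_normal_density x) \<partial>lborel)
      / ennreal (varsigma ^ k * real (odd_double_fact k)) \<le> 1" for k
  proof -
    have pos: "0 < real (odd_double_fact k)" unfolding odd_double_fact_eq by simp
    have "(\<integral>\<^sup>+ x. ennreal (\<bar>x\<bar> ^ (2 * k) * std_normal_density x) \<partial>lborel) = ennreal (real (odd_double_fact k))"
      using std_normal_moment_even[of k] unfolding odd_double_fact_eq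
      by (subst nn_integral_eq_integral) (auto simp: has_bochner_integral_iff power_even_abs mult.commute zero_le_even_power)
    also have "\<dots> \<le> ennreal (varsigma ^ k * real (odd_double_fact k))"
      using assms pos by (intro ennreal_leI) (simp add: mult_le_cancel_right1)
    finally show ?thesis
      using assms pos by (intro divide_le_posI_ennreal) auto
  qed
  then show ?thesis
    using std_normal_moment_even[of 0] std_normal_moment_even[of 1] std_normal_moment_odd[of 0]
    by (auto simp: noise_densities_def mult.commute intro!: SUP_least)
qed

section \<open>A flat-topped cutoff function\<close>

text \<open>Squared positive part: a C^1 function vanishing on a half-line, from which the bump is
  assembled.\<close>

definition pos_sq :: "real \<Rightarrow> real" where
  "pos_sq x = (max 0 x)\<^sup>2"

lemma has_real_derivative_pos_sq: "(pos_sq has_real_derivative 2 * max 0 x) (at x)"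
proof -
  consider "x < 0" | "x = 0" | "0 < x" by linarith
  then show ?thesis
  proof cases
    case 1
    have "((\<lambda>_. 0) has_real_derivative 2 * max 0 x) (at x)" using 1 by simp
    then show ?thesis
      by (rule has_field_derivative_transform_within[where d="- x"]) (use 1 in \<open>auto simp: pos_sq_def dist_real_def\<close>)
  next
    case 2
    \<comment> \<open>At the kink the difference quotient is bounded by |y|.\<close>
    have "((\<lambda>y. pos_sq y / y) \<longlongrightarrow> 0) (at 0)"
    proof (rule tendsto_rabs_zero_cancel, rule tendsto_sandwich[of "\<lambda>_. 0" _ _ "\<lambda>y. \<bar>y\<bar>"])
      show "\<forall>\<^sub>F y in at 0. \<bar>pos_sq y / y\<bar> \<le> \<bar>y\<bar>"
        by (intro always_eventually) (auto simp: pos_sq_def power2_eq_square max_def)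
      show "((\<lambda>y. \<bar>y\<bar>) \<longlongrightarrow> 0) (at (0::real))" by (auto intro!: tendsto_eq_intros)
    qed auto
    then show ?thesis using 2 by (simp add: has_field_derivative_iff pos_sq_def)
  next
    case 3
    have "((\<lambda>y. y\<^sup>2) has_real_derivative 2 * max 0 x) (at x)"
      using 3 by (auto intro!: derivative_eq_intros)
    then show ?thesis
      by (rule has_field_derivative_transform_within[where d="x"]) (use 3 in \<open>auto simp: pos_sq_def dist_real_def\<close>)
  qed
qed

(* A C^1 bump that is identically 1 on [-1,1], so that local_osc vanishes on its multiples, and
   vanishes outside [-1-\<nu>,1+\<nu>], so that its squared L2 norm is at most 2 + 2 \<nu>. *)
definition cutoff :: "real \<Rightarrow> real \<Rightarrow> real" where
  "cutoff \<nu> t = pos_sq (1 - pos_sq ((t - 1) / \<nu>) - pos_sq ((- t - 1) / \<nu>))"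

definition cutoff_deriv :: "real \<Rightarrow> real \<Rightarrow> real" where
  "cutoff_deriv \<nu> t = 2 * max 0 (1 - pos_sq ((t - 1) / \<nu>) - pos_sq ((- t - 1) / \<nu>))
     * (2 * max 0 ((- t - 1) / \<nu>) / \<nu> - 2 * max 0 ((t - 1) / \<nu>) / \<nu>)"

context
  fixes \<nu> :: real
  assumes \<nu>: "0 < \<nu>"
begin

lemma cutoff_eq_1:
  assumes "\<bar>t\<bar> \<le> 1"
  shows "cutoff \<nu> t = 1"
proof -
  have "(t - 1) / \<nu> \<le> 0" "(- t - 1) / \<nu> \<le> 0" using assms \<nu> by (auto simp: divide_le_0_iff)
  then show ?thesis by (simp add: cutoff_def pos_sq_def max_absorb1)
qed

lemma cutoff_eq_0:
  assumes "1 + \<nu> \<le> \<bar>t\<bar>"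
  shows "cutoff \<nu> t = 0"
proof -
  have "1 \<le> (t - 1) / \<nu> \<or> 1 \<le> (- t - 1) / \<nu>" using assms \<nu> by (auto simp: field_simps)
  then have "1 \<le> pos_sq ((t - 1) / \<nu>) \<or> 1 \<le> pos_sq ((- t - 1) / \<nu>)"
    by (auto simp: pos_sq_def)
  moreover have "0 \<le> pos_sq ((t - 1) / \<nu>)" "0 \<le> pos_sq ((- t - 1) / \<nu>)" by (auto simp: pos_sq_def)
  ultimately have "1 - pos_sq ((t - 1) / \<nu>) - pos_sq ((- t - 1) / \<nu>) \<le> 0" by linarith
  then show ?thesis by (simp add: cutoff_def pos_sq_def[of "1 - _ - _"] max_def)
qed

lemma cutoff_bounds: "0 \<le> cutoff \<nu> t" "cutoff \<nu> t \<le> 1"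
proof -
  have "0 \<le> pos_sq ((t - 1) / \<nu>)" "0 \<le> pos_sq ((- t - 1) / \<nu>)" by (auto simp: pos_sq_def)
  then show "0 \<le> cutoff \<nu> t" "cutoff \<nu> t \<le> 1"
    unfolding cutoff_def pos_sq_def[of "1 - _ - _"] by (auto intro!: power_le_one)
qed

lemma has_real_derivative_cutoff:
  "(cutoff \<nu> has_real_derivative cutoff_deriv \<nu> t) (at t)"
proof -
  have "((\<lambda>t. pos_sq ((t - 1) / \<nu>)) has_real_derivative 2 * max 0 ((t - 1) / \<nu>) * (1 / \<nu>)) (at t)"
    by (rule DERIV_chain2[OF has_real_derivative_pos_sq]) (use \<nu> in \<open>auto intro!: derivative_eq_intros\<close>)
  moreover have "((\<lambda>t. pos_sq ((- t - 1) / \<nu>)) has_real_derivative 2 * max 0 ((- t - 1) / \<nu>) * (- 1 / \<nu>)) (at t)"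
    by (rule DERIV_chain2[OF has_real_derivative_pos_sq]) (use \<nu> in \<open>auto intro!: derivative_eq_intros\<close>)
  ultimately have "((\<lambda>t. 1 - pos_sq ((t - 1) / \<nu>) - pos_sq ((- t - 1) / \<nu>)) has_real_derivative
      2 * max 0 ((- t - 1) / \<nu>) / \<nu> - 2 * max 0 ((t - 1) / \<nu>) / \<nu>) (at t)"
    by (auto intro!: derivative_eq_intros)
  from DERIV_chain2[OF has_real_derivative_pos_sq this] show ?thesis
    unfolding cutoff_def[abs_def] cutoff_deriv_def .
qed

lemma continuous_on_cutoff_deriv: "continuous_on A (cutoff_deriv \<nu>)"
  unfolding cutoff_deriv_def[abs_def] pos_sq_def[abs_def] using \<nu> by (intro continuous_intros) auto

text \<open>With A and B the two positive parts and C = max 0 (1 - A^2 - B^2), the derivative is (4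
  / nu) C (B - A). Where C > 0, both A and B lie in [0,1], so |B - A| <= 1.\<close>

lemma abs_cutoff_deriv_le: "\<bar>cutoff_deriv \<nu> t\<bar> \<le> 4 / \<nu>"
proof -
  define A where "A = max 0 ((t - 1) / \<nu>)"
  define B where "B = max 0 ((- t - 1) / \<nu>)"
  define C where "C = max 0 (1 - A\<^sup>2 - B\<^sup>2)"
  have eq: "cutoff_deriv \<nu> t = 4 / \<nu> * (C * (B - A))"
    by (simp add: cutoff_deriv_def pos_sq_def A_def B_def C_def right_diff_distrib)
  have AB: "0 \<le> A" "0 \<le> B" and C: "0 \<le> C" "C \<le> 1" by (auto simp: A_def B_def C_def)
  have "\<bar>C * (B - A)\<bar> \<le> 1"
  proof (cases "C = 0")
    case False
    then have "A\<^sup>2 + B\<^sup>2 \<le> 1\<^sup>2" by (auto simp: C_def max_def split: if_splits)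
    moreover have "0 \<le> A\<^sup>2" "0 \<le> B\<^sup>2" by auto
    ultimately have "A\<^sup>2 \<le> 1\<^sup>2" "B\<^sup>2 \<le> 1\<^sup>2" by linarith+
    then have "A \<le> 1" "B \<le> 1" by (auto intro: power2_le_imp_le simp del: one_power2)
    then have "\<bar>B - A\<bar> \<le> 1" using AB by linarith
    then show ?thesis using C by (simp add: abs_mult mult_le_one)
  qed simp
  then have "4 / \<nu> * \<bar>C * (B - A)\<bar> \<le> 4 / \<nu> * 1" using \<nu> by (intro mult_left_mono) auto
  then show ?thesis using \<nu> unfolding eq by (simp add: abs_mult)
qed

text \<open>Rescaling the argument by \<open>h\<close> multiplies the derivative, bounded by 4 / nu
  for the cutoff itself, by 1 / h.\<close>

lemma scaled_cutoff_in_stable_class: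
  fixes \<epsilon> L c h z0 :: real
  assumes h: "0 < h" and c: "\<bar>c\<bar> \<le> 1 - \<epsilon>" "\<bar>c\<bar> * (4 / \<nu>) / h \<le> L"
  shows "(\<lambda>x. c * cutoff \<nu> ((x - z0) / h)) \<in> stable_class \<epsilon> L"
proof -
  let ?S' = "\<lambda>x. c * (cutoff_deriv \<nu> ((x - z0) / h) / h)"
  have "continuous_on {0..1} ?S'"
    using h by (intro continuous_intros continuous_on_compose2[OF continuous_on_cutoff_deriv[of UNIV]]) auto
  moreover have "((\<lambda>x. c * cutoff \<nu> ((x - z0) / h)) has_real_derivative ?S' x) (at x within {0..1})" for x
    by (rule has_field_derivative_at_within)
       (use h in \<open>auto intro!: derivative_eq_intros DERIV_chain2[OF has_real_derivative_cutoff]\<close>)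
  moreover have "\<bar>c * cutoff \<nu> ((x - z0) / h)\<bar> \<le> 1 - \<epsilon>" for x
  proof -
    have "\<bar>c * cutoff \<nu> ((x - z0) / h)\<bar> \<le> \<bar>c\<bar> * 1"
      using cutoff_bounds by (subst abs_mult, intro mult_left_mono) (auto simp: abs_le_iff)
    then show ?thesis using c by simp
  qed
  moreover have "\<bar>?S' x\<bar> \<le> L" for x
  proof -
    have "\<bar>?S' x\<bar> \<le> \<bar>c\<bar> * ((4 / \<nu>) / h)"
      using h abs_cutoff_deriv_le unfolding abs_mult abs_divide abs_of_pos[OF h]
      by (intro mult_left_mono divide_right_mono) auto
    then show ?thesis using c by simp
  qed
  ultimately show ?thesis unfolding stable_class_def by blast
qed

text \<open>The function is constant on [z0 - h, z0 + h], the only region that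
  \<open>local_osc\<close> sees. Hence it satisfies the oscillation bound for every nonnegative weak
  Hoelder constant.\<close>

lemma local_osc_scaled_cutoff:
  assumes "0 < h"
  shows "local_osc h z0 (\<lambda>x. c * cutoff \<nu> ((x - z0) / h)) = 0"
proof -
  have "integral {-1..1} (\<lambda>u. c * cutoff \<nu> ((z0 + u * h - z0) / h) - c * cutoff \<nu> ((z0 - z0) / h))
      = integral {-1..1} (\<lambda>u :: real. 0 :: real)"
    using assms by (intro Henstock_Kurzweil_Integration.integral_cong) (auto simp: cutoff_eq_1)
  then show ?thesis by (simp add: local_osc_def)
qed

text \<open>The squared cutoff lies between the indicators of the windows of half-width h and (1 +
  nu) h about z0, and the number of design points in a window of half-width s differs from 2 n s by
  at most 1.\<close>

lemma sum_cutoff_design_bounds: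
  fixes h z0 :: real and n :: nat
  assumes h: "0 < h" and n: "0 < n" and win: "(1 + \<nu>) * h + 1 / n \<le> z0" "z0 + (1 + \<nu>) * h \<le> 1"
  shows "2 * (n * h) - 1 \<le> (\<Sum>k=1..n. (cutoff \<nu> ((k / n - z0) / h))\<^sup>2)"
    and "(\<Sum>k=1..n. (cutoff \<nu> ((k / n - z0) / h))\<^sup>2) \<le> 2 * (1 + \<nu>) * (n * h) + 1"
proof -
  \<comment> \<open>Indices of the design points within \<open>s\<close> of \<open>z0\<close>,
    written as an integer interval so that they can be counted.\<close>
  define Q where "Q s = {nat \<lceil>n * (z0 - s)\<rceil>..nat \<lfloor>n * (z0 + s)\<rfloor>}" for s
  have Q: "k \<in> Q s \<longleftrightarrow> \<bar>real k / n - z0\<bar> \<le> s" if "0 \<le> s" "s \<le> (1 + \<nu>) * h" for k s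
  proof -
    have "0 \<le> z0 - s" using that win n by (smt (verit) divide_nonneg_nonneg of_nat_0_le_iff)
    then have z: "0 \<le> n * (z0 - s)" "0 \<le> n * (z0 + s)" using that by auto
    have "k \<in> Q s \<longleftrightarrow> n * (z0 - s) \<le> k \<and> k \<le> n * (z0 + s)"
      using z by (simp add: Q_def nat_le_iff le_nat_iff ceiling_le_iff le_floor_iff)
    also have "\<dots> \<longleftrightarrow> z0 - s \<le> real k / n \<and> real k / n \<le> z0 + s"
      using n by (simp add: field_simps)
    finally show ?thesis by (simp add: abs_le_iff; linarith)
  qed
  have card: "2 * (n * s) - 1 \<le> real (card (Q s))" "real (card (Q s)) \<le> 2 * (n * s) + 1"
    if "0 \<le> s" "s \<le> (1 + \<nu>) * h" for s :: real
  proof -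
    have "0 \<le> z0 - s" using that win n by (smt (verit) divide_nonneg_nonneg of_nat_0_le_iff)
    then have z: "0 \<le> n * (z0 - s)" "n * (z0 - s) \<le> n * (z0 + s)" using that n by auto
    define p where "p = n * (z0 - s)"
    define q where "q = n * (z0 + s)"
    have pq: "0 \<le> p" "p \<le> q" "q - p = 2 * (n * s)" using z by (auto simp: p_def q_def algebra_simps)
    \<comment> \<open>The last inequality keeps the count right for an empty window, where the
      ceiling of \<open>p\<close> is the floor of \<open>q\<close> plus 1.\<close>
    have "0 \<le> \<lceil>p\<rceil>" "0 \<le> \<lfloor>q\<rfloor>" "\<lceil>p\<rceil> \<le> \<lfloor>q\<rfloor> + 1" using pq by linarith+
    have "real (card (Q s)) = \<lfloor>q\<rfloor> + 1 - \<lceil>p\<rceil>"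
    proof -
      have "card (Q s) = nat (\<lfloor>q\<rfloor> + 1 - \<lceil>p\<rceil>)"
        unfolding Q_def p_def[symmetric] q_def[symmetric] card_atLeastAtMost
        using \<open>0 \<le> \<lceil>p\<rceil>\<close> \<open>0 \<le> \<lfloor>q\<rfloor>\<close> by linarith
      then show ?thesis using \<open>\<lceil>p\<rceil> \<le> \<lfloor>q\<rfloor> + 1\<close> by simp
    qed
    then show "2 * (n * s) - 1 \<le> real (card (Q s))" "real (card (Q s)) \<le> 2 * (n * s) + 1"
      unfolding pq(3)[symmetric] by linarith+
  qed
  have sub: "Q s \<subseteq> {1..n}" if "0 \<le> s" "s \<le> (1 + \<nu>) * h" for s
  proof
    fix k assume "k \<in> Q s"
    then have k: "\<bar>real k / n - z0\<bar> \<le> s" using Q that by simp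
    \<comment> \<open>The margin \<open>1 / n\<close> in \<open>win\<close> excludes the index
      0.\<close>
    then have "1 / real n \<le> real k / n" "real k / n \<le> 1" using win that by linarith+
    then show "k \<in> {1..n}" using n by (simp add: field_simps)
  qed
  have h1: "h \<le> (1 + \<nu>) * h" using h \<nu> by (simp add: algebra_simps)
  have one: "cutoff \<nu> ((k / n - z0) / h) = 1" if "k \<in> Q h" for k :: nat
    using that h h1 Q[of h k] by (intro cutoff_eq_1) (auto simp: abs_divide field_simps)
  have zero: "cutoff \<nu> ((k / n - z0) / h) = 0" if "k \<notin> Q ((1 + \<nu>) * h)" for k :: nat
    using that h \<nu> Q[of "(1 + \<nu>) * h" k] by (intro cutoff_eq_0) (auto simp: abs_divide field_simps)
  have "2 * (n * h) - 1 \<le> (\<Sum>k\<in>Q h. (cutoff \<nu> ((k / n - z0) / h))\<^sup>2)"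
    using card(1)[of h] h h1 by (simp add: one)
  also have "\<dots> \<le> (\<Sum>k=1..n. (cutoff \<nu> ((k / n - z0) / h))\<^sup>2)"
    using sub[of h] h h1 by (intro sum_mono2) auto
  finally show "2 * (n * h) - 1 \<le> (\<Sum>k=1..n. (cutoff \<nu> ((k / n - z0) / h))\<^sup>2)" .
  have "(\<Sum>k=1..n. (cutoff \<nu> ((k / n - z0) / h))\<^sup>2) = (\<Sum>k\<in>Q ((1 + \<nu>) * h). (cutoff \<nu> ((k / n - z0) / h))\<^sup>2)"
    using sub[of "(1 + \<nu>) * h"] h \<nu> zero by (intro sum.mono_neutral_right) auto
  also have "\<dots> \<le> (\<Sum>k\<in>Q ((1 + \<nu>) * h). 1)"
    using cutoff_bounds by (intro sum_mono power_le_one) auto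
  also have "\<dots> \<le> 2 * (1 + \<nu>) * (n * h) + 1"
    using card(2)[of "(1 + \<nu>) * h"] h \<nu> by (simp add: algebra_simps)
  finally show "(\<Sum>k=1..n. (cutoff \<nu> ((k / n - z0) / h))\<^sup>2) \<le> 2 * (1 + \<nu>) * (n * h) + 1" .
qed

end

text \<open>To be used with \<open>y\<close> the autoregressive path and \<open>x\<close> its noise.
  Young's inequality with parameter \<open>d\<close> splits the squares, and \<open>diff\<close>
  turns the remainder into \<open>d + d\<^sup>2\<close> times the \<open>y\<close>-sum, because (1 +
  1/d) d^2 = d + d^2.\<close>

lemma weighted_sum_squares_perturbation:
  fixes c x y :: "'i \<Rightarrow> real" and d :: real
  assumes c: "\<And>i. i \<in> A \<Longrightarrow> 0 \<le> c i" and d: "0 < d"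
    and diff: "(\<Sum>i\<in>A. c i * (y i - x i)\<^sup>2) \<le> d\<^sup>2 * (\<Sum>i\<in>A. c i * (y i)\<^sup>2)"
  shows "(\<Sum>i\<in>A. c i * (x i)\<^sup>2) \<le> (1 + d)\<^sup>2 * (\<Sum>i\<in>A. c i * (y i)\<^sup>2)"
    and "(1 - d - d\<^sup>2) * (\<Sum>i\<in>A. c i * (y i)\<^sup>2) \<le> (1 + d) * (\<Sum>i\<in>A. c i * (x i)\<^sup>2)"
proof -
  have young: "p\<^sup>2 \<le> (1 + d) * q\<^sup>2 + (1 + 1 / d) * (p - q)\<^sup>2" for p q :: real
  proof -
    have "(1 + d) * q\<^sup>2 + (1 + 1 / d) * (p - q)\<^sup>2 - p\<^sup>2 = (d * q - (p - q))\<^sup>2 / d"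
      using d by (simp add: field_simps power2_eq_square)
    also have "\<dots> \<ge> 0" using d by simp
    finally show ?thesis by simp
  qed
  have sum_young: "(\<Sum>i\<in>A. c i * (p i)\<^sup>2) \<le> (1 + d) * (\<Sum>i\<in>A. c i * (q i)\<^sup>2) + (1 + 1 / d) * (\<Sum>i\<in>A. c i * (p i - q i)\<^sup>2)"
    for p q :: "'i \<Rightarrow> real"
  proof -
    have "(\<Sum>i\<in>A. c i * (p i)\<^sup>2) \<le> (\<Sum>i\<in>A. c i * ((1 + d) * (q i)\<^sup>2 + (1 + 1 / d) * (p i - q i)\<^sup>2))"
      using c young by (intro sum_mono mult_left_mono) auto
    then show ?thesis by (simp add: distrib_left sum.distrib sum_distrib_left mult_ac)
  qed
  have "(1 + 1 / d) * (\<Sum>i\<in>A. c i * (y i - x i)\<^sup>2) \<le> (1 + 1 / d) * (d\<^sup>2 * (\<Sum>i\<in>A. c i * (y i)\<^sup>2))"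
    using d by (intro mult_left_mono diff) auto
  also have "\<dots> = (d + d\<^sup>2) * (\<Sum>i\<in>A. c i * (y i)\<^sup>2)"
    using d by (simp add: field_simps power2_eq_square)
  finally have *: "(1 + 1 / d) * (\<Sum>i\<in>A. c i * (y i - x i)\<^sup>2) \<le> (d + d\<^sup>2) * (\<Sum>i\<in>A. c i * (y i)\<^sup>2)" .
  have "(\<Sum>i\<in>A. c i * (x i)\<^sup>2) \<le> (1 + d) * (\<Sum>i\<in>A. c i * (y i)\<^sup>2) + (d + d\<^sup>2) * (\<Sum>i\<in>A. c i * (y i)\<^sup>2)"
    using sum_young[of x y] * by (simp add: power2_commute)
  then show "(\<Sum>i\<in>A. c i * (x i)\<^sup>2) \<le> (1 + d)\<^sup>2 * (\<Sum>i\<in>A. c i * (y i)\<^sup>2)"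
    by (simp add: power2_sum algebra_simps)
  show "(1 - d - d\<^sup>2) * (\<Sum>i\<in>A. c i * (y i)\<^sup>2) \<le> (1 + d) * (\<Sum>i\<in>A. c i * (x i)\<^sup>2)"
    using sum_young[of y x] * by (simp add: algebra_simps)
qed

section \<open>Concentration of the observed information\<close>

text \<open>Moves weights from the lagged value at \<open>k\<close> to the value at
  \<open>i = k - 1\<close>; the vanishing end terms preserve the range. For the information, the
  first end term is the one that carries \<open>y0\<close>.\<close>

lemma sum_shift_vanishing_ends:
  fixes f :: "nat \<Rightarrow> real"
  assumes "f 1 = 0" "f (Suc n) = 0"
  shows "(\<Sum>k=1..n. f k) = (\<Sum>i=1..n. f (Suc i))"
proof -
  have "(\<Sum>k=1..n. f k) = (\<Sum>k=1..Suc n. f k)" using assms by simp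
  also have "\<dots> = f 1 + (\<Sum>k=Suc 1..Suc n. f k)" by (rule sum.atLeast_Suc_atMost) simp
  also have "\<dots> = (\<Sum>i=1..n. f (Suc i))" using assms by (subst sum.shift_bounds_cl_Suc_ivl) simp
  finally show ?thesis .
qed

text \<open>Input for Chebyshev's inequality: with fourth moment 3, the variance of the square is 3
  - 2 + 1 = 2.\<close>

lemma std_normal_square_fluctuation:
  defines "D \<equiv> density lborel std_normal_density"
  shows "integrable D (\<lambda>x. x\<^sup>2 - 1)" "(\<integral>x. x\<^sup>2 - 1 \<partial>D) = 0"
    "integrable D (\<lambda>x. (x\<^sup>2 - 1)\<^sup>2)" "(\<integral>x. (x\<^sup>2 - 1)\<^sup>2 \<partial>D) = 2"
proof -
  have m: "has_bochner_integral lborel std_normal_density 1"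
      "has_bochner_integral lborel (\<lambda>x. std_normal_density x * x\<^sup>2) 1"
      "has_bochner_integral lborel (\<lambda>x. std_normal_density x * x ^ 4) 3"
    using std_normal_moment_even[of 0] std_normal_moment_even[of 1] std_normal_moment_even[of 2]
    by (simp_all add: fact_numeral)
  have e: "std_normal_density x * (x\<^sup>2 - 1)\<^sup>2
      = std_normal_density x * x ^ 4 - 2 * (std_normal_density x * x\<^sup>2) + std_normal_density x" for x :: real
    by (simp add: power2_diff right_diff_distrib distrib_left flip: power_mult)
  have 1: "has_bochner_integral lborel (\<lambda>x. std_normal_density x * (x\<^sup>2 - 1)) 0"
    using has_bochner_integral_diff[OF m(2) m(1)] by (simp add: right_diff_distrib)
  have 2: "has_bochner_integral lborel (\<lambda>x. std_normal_density x * (x\<^sup>2 - 1)\<^sup>2) 2"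
    using has_bochner_integral_add[OF has_bochner_integral_diff[OF m(3)
        has_bochner_integral_mult_right[OF m(2), of 2]] m(1)]
    unfolding e by simp
  show "integrable D (\<lambda>x. x\<^sup>2 - 1)" "(\<integral>x. x\<^sup>2 - 1 \<partial>D) = 0"
    "integrable D (\<lambda>x. (x\<^sup>2 - 1)\<^sup>2)" "(\<integral>x. (x\<^sup>2 - 1)\<^sup>2 \<partial>D) = 2"
    unfolding D_def using 1 2
    by (auto simp: integrable_density integral_density has_bochner_integral_iff)
qed

(* The observed Fisher information of the family S(k/n) = u w k at the sample y. *)
definition ar_information :: "(nat \<Rightarrow> real) \<Rightarrow> nat \<Rightarrow> real \<Rightarrow> (nat \<Rightarrow> real) \<Rightarrow> real" where
  "ar_information w n y0 y = (\<Sum>k=1..n. (w k * (y(0 := y0)) (k - 1))\<^sup>2)"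

lemma measurable_ar_information [measurable]:
  "ar_information w n y0 \<in> borel_measurable (obs_space n)"
  unfolding ar_information_def[abs_def]
  by (intro borel_measurable_sum borel_measurable_power borel_measurable_times
      borel_measurable_const measurable_lag)

text \<open>By the recursion y_i - xi_i = u w_i y_(i-1), and |u w_(i+1)| <= d. So the weighted
  square sum of the differences between path and noise is at most d^2 times the information itself,
  and the perturbation lemma applies.\<close>

lemma ar_information_ar_path_bounds:
  fixes w \<xi> :: "nat \<Rightarrow> real" and S :: "real \<Rightarrow> real" and n :: nat and y0 u a d :: real
  defines "Y \<equiv> \<lambda>\<xi>. ar_information w n y0 (\<lambda>k\<in>{1..n}. ar_path n y0 S \<xi> k)"
  assumes S: "\<And>k. k \<in> {1..n} \<Longrightarrow> S (real k / real n) = u * w k"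
    and ends: "w 1 = 0" "w (Suc n) = 0"
    and a: "\<And>k. \<bar>w k\<bar> \<le> a" "\<bar>u\<bar> * a \<le> d" and d: "0 < d"
  shows "(\<Sum>i=1..n. (w (Suc i))\<^sup>2 * (\<xi> i)\<^sup>2) \<le> (1 + d)\<^sup>2 * Y \<xi>"
    and "(1 - d - d\<^sup>2) * Y \<xi> \<le> (1 + d) * (\<Sum>i=1..n. (w (Suc i))\<^sup>2 * (\<xi> i)\<^sup>2)"
proof -
  let ?y = "ar_path n y0 S \<xi>"
  have lag: "((\<lambda>k\<in>{1..n}. ?y k)(0 := y0)) (k - 1) = ?y (k - 1)" if "k \<in> {1..n}" for k
    using that by auto
  \<comment> \<open>The information is indexed in two ways: \<open>Y1\<close> matches the bound on
    the differences, \<open>Y2\<close> the weighted sum compared with the noise.\<close>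
  have Y1: "Y \<xi> = (\<Sum>k=1..n. (w k * ?y (k - 1))\<^sup>2)"
    unfolding Y_def ar_information_def using lag by (intro sum.cong) simp_all
  also have "\<dots> = (\<Sum>i=1..n. (w (Suc i))\<^sup>2 * (?y i)\<^sup>2)"
    using ends by (subst sum_shift_vanishing_ends) (auto simp: power_mult_distrib)
  finally have Y2: "Y \<xi> = (\<Sum>i=1..n. (w (Suc i))\<^sup>2 * (?y i)\<^sup>2)" .
  have "(\<Sum>i=1..n. (w (Suc i))\<^sup>2 * (?y i - \<xi> i)\<^sup>2) \<le> (\<Sum>i=1..n. d\<^sup>2 * (w i * ?y (i - 1))\<^sup>2)"
  proof (rule sum_mono)
    fix i assume i: "i \<in> {1..n}"
    then obtain j where j: "i = Suc j" by (cases i) auto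
    then have eq: "?y i - \<xi> i = u * (w i * ?y (i - 1))" using S[OF i] by simp
    have "\<bar>w (Suc i) * u\<bar> \<le> d"
    proof -
      have "\<bar>w (Suc i) * u\<bar> \<le> a * \<bar>u\<bar>" using a(1)[of "Suc i"] by (simp add: abs_mult mult_right_mono)
      then show ?thesis using a(2) by (simp add: mult.commute)
    qed
    then have "(w (Suc i) * u)\<^sup>2 \<le> d\<^sup>2" unfolding abs_le_square_iff[symmetric] using d by simp
    then have "(w (Suc i) * u)\<^sup>2 * (w i * ?y (i - 1))\<^sup>2 \<le> d\<^sup>2 * (w i * ?y (i - 1))\<^sup>2"
      by (rule mult_right_mono) simp
    then show "(w (Suc i))\<^sup>2 * (?y i - \<xi> i)\<^sup>2 \<le> d\<^sup>2 * (w i * ?y (i - 1))\<^sup>2"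
      unfolding eq by (simp add: power_mult_distrib mult_ac)
  qed
  also have "\<dots> = d\<^sup>2 * Y \<xi>" unfolding Y1 by (simp add: sum_distrib_left)
  finally have "(\<Sum>i=1..n. (w (Suc i))\<^sup>2 * (?y i - \<xi> i)\<^sup>2) \<le> d\<^sup>2 * (\<Sum>i=1..n. (w (Suc i))\<^sup>2 * (?y i)\<^sup>2)"
    unfolding Y2 .
  from weighted_sum_squares_perturbation[OF _ d this]
  show "(\<Sum>i=1..n. (w (Suc i))\<^sup>2 * (\<xi> i)\<^sup>2) \<le> (1 + d)\<^sup>2 * Y \<xi>"
    and "(1 - d - d\<^sup>2) * Y \<xi> \<le> (1 + d) * (\<Sum>i=1..n. (w (Suc i))\<^sup>2 * (\<xi> i)\<^sup>2)"
    unfolding Y2 by simp_all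
qed

text \<open>The weighted sum of squared noise has mean in [lo,hi] and variance at most
  \<open>2 * (a\<^sup>2 * hi)\<close>. Unless it deviates from its mean by \<open>\<tau>\<close> or
  more, the pathwise bounds and the conditions on \<open>\<tau>\<close> place the information in
  [1,J].\<close>

lemma ar_information_concentration:
  fixes w :: "nat \<Rightarrow> real" and S :: "real \<Rightarrow> real" and n :: nat and y0 u a d lo hi \<tau> J :: real
  defines "Y \<equiv> \<lambda>\<xi>. ar_information w n y0 (\<lambda>k\<in>{1..n}. ar_path n y0 S \<xi> k)"
  assumes S: "\<And>k. k \<in> {1..n} \<Longrightarrow> S (real k / real n) = u * w k"
    and ends: "w 1 = 0" "w (Suc n) = 0"
    and a: "\<And>k. \<bar>w k\<bar> \<le> a" "\<bar>u\<bar> * a \<le> d" and d: "0 < d"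
    and sum: "lo \<le> (\<Sum>k=1..n. (w k)\<^sup>2)" "(\<Sum>k=1..n. (w k)\<^sup>2) \<le> hi"
    and \<tau>: "0 < \<tau>" "(1 + d)\<^sup>2 \<le> lo - \<tau>" "(1 + d) * (hi + \<tau>) \<le> (1 - d - d\<^sup>2) * J" "0 < 1 - d - d\<^sup>2"
  shows "1 - 2 * (a\<^sup>2 * hi) / \<tau>\<^sup>2 \<le> measure (noise_law n std_normal_density)
    {\<xi> \<in> space (noise_law n std_normal_density). 1 \<le> Y \<xi> \<and> Y \<xi> \<le> J}"
proof -
  let ?P = "noise_law n std_normal_density"
  interpret P: prob_space ?P by (rule prob_space_PiM) (rule prob_space_std_normal)
  have Ym [measurable]: "Y \<in> borel_measurable ?P"
    unfolding Y_def by (rule measurable_compose[OF measurable_ar_path measurable_ar_information])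
  \<comment> \<open>The weighted sum of squared noise, centred at its mean.\<close>
  define X where "X \<xi> = (\<Sum>i=1..n. (w (Suc i))\<^sup>2 * ((\<xi> i)\<^sup>2 - 1))" for \<xi> :: "nat \<Rightarrow> real"
  have Xm [measurable]: "X \<in> borel_measurable ?P"
  proof -
    have "(\<lambda>\<xi>. \<xi> i) \<in> borel_measurable ?P" if "i \<in> {1..n}" for i
      using measurable_component_singleton[OF that, of "\<lambda>_. borel :: real measure"]
      by (simp cong: measurable_cong_sets)
    then show ?thesis unfolding X_def[abs_def]
      by (intro borel_measurable_sum borel_measurable_times borel_measurable_diff borel_measurable_power
          borel_measurable_const)
  qed
  have tot: "(\<Sum>i=1..n. (w (Suc i))\<^sup>2) = (\<Sum>k=1..n. (w k)\<^sup>2)"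
    using ends by (intro sum_shift_vanishing_ends[symmetric]) auto
  have "P.prob {\<xi> \<in> space ?P. \<tau> \<le> \<bar>X \<xi>\<bar>} \<le> 2 * (\<Sum>i=1..n. ((w (Suc i))\<^sup>2)\<^sup>2) / \<tau>\<^sup>2"
    using prob_weighted_iid_sum_ge[OF prob_space_std_normal _ \<tau>(1) std_normal_square_fluctuation(1-3),
        of "{1..n}" "\<lambda>i. (w (Suc i))\<^sup>2"]
    unfolding X_def std_normal_square_fluctuation(4) by simp
  also have "\<dots> \<le> 2 * (a\<^sup>2 * hi) / \<tau>\<^sup>2"
  proof -
    have a0: "0 \<le> a" using a(1)[of 0] by linarith
    have w2: "(w i)\<^sup>2 \<le> a\<^sup>2" for i unfolding abs_le_square_iff[symmetric] using a(1)[of i] a0 by simp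
    have "(\<Sum>i=1..n. ((w (Suc i))\<^sup>2)\<^sup>2) \<le> (\<Sum>i=1..n. a\<^sup>2 * (w (Suc i))\<^sup>2)"
      unfolding power2_eq_square[of "(w _)\<^sup>2"] by (intro sum_mono mult_right_mono w2) simp
    also have "\<dots> \<le> a\<^sup>2 * hi"
      unfolding sum_distrib_left[symmetric] tot using sum by (intro mult_left_mono) auto
    finally show ?thesis by (intro divide_right_mono) auto
  qed
  finally have "1 - 2 * (a\<^sup>2 * hi) / \<tau>\<^sup>2 \<le> 1 - P.prob {\<xi> \<in> space ?P. \<tau> \<le> \<bar>X \<xi>\<bar>}" by simp
  also have "\<dots> = P.prob {\<xi> \<in> space ?P. \<not> \<tau> \<le> \<bar>X \<xi>\<bar>}"
    by (rule P.prob_neg[symmetric]) measurable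
  also have "\<dots> \<le> P.prob {\<xi> \<in> space ?P. 1 \<le> Y \<xi> \<and> Y \<xi> \<le> J}"
  proof (rule P.finite_measure_mono)
    show "{\<xi> \<in> space ?P. 1 \<le> Y \<xi> \<and> Y \<xi> \<le> J} \<in> P.events" by measurable
    show "{\<xi> \<in> space ?P. \<not> \<tau> \<le> \<bar>X \<xi>\<bar>} \<subseteq> {\<xi> \<in> space ?P. 1 \<le> Y \<xi> \<and> Y \<xi> \<le> J}"
    proof safe
      fix \<xi> assume "\<not> \<tau> \<le> \<bar>X \<xi>\<bar>"
      moreover have "X \<xi> = (\<Sum>i=1..n. (w (Suc i))\<^sup>2 * (\<xi> i)\<^sup>2) - (\<Sum>k=1..n. (w k)\<^sup>2)"
        unfolding X_def tot[symmetric] by (simp add: right_diff_distrib sum_subtractf)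
      ultimately have I0: "lo - \<tau> \<le> (\<Sum>i=1..n. (w (Suc i))\<^sup>2 * (\<xi> i)\<^sup>2)"
          "(\<Sum>i=1..n. (w (Suc i))\<^sup>2 * (\<xi> i)\<^sup>2) \<le> hi + \<tau>"
        using sum by linarith+
      have bounds: "(\<Sum>i=1..n. (w (Suc i))\<^sup>2 * (\<xi> i)\<^sup>2) \<le> (1 + d)\<^sup>2 * Y \<xi>"
          "(1 - d - d\<^sup>2) * Y \<xi> \<le> (1 + d) * (\<Sum>i=1..n. (w (Suc i))\<^sup>2 * (\<xi> i)\<^sup>2)"
        unfolding Y_def by (rule ar_information_ar_path_bounds[OF S ends a d]; assumption)+
      have "(1 + d)\<^sup>2 * 1 \<le> (1 + d)\<^sup>2 * Y \<xi>" using \<tau>(2) I0(1) bounds(1) by linarith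
      then show "1 \<le> Y \<xi>" using d by (subst (asm) mult_le_cancel_left_pos) auto
      have "(1 + d) * (\<Sum>i=1..n. (w (Suc i))\<^sup>2 * (\<xi> i)\<^sup>2) \<le> (1 + d) * (hi + \<tau>)"
        using I0(2) d by (intro mult_left_mono) auto
      then have "(1 - d - d\<^sup>2) * Y \<xi> \<le> (1 - d - d\<^sup>2) * J" using \<tau>(3) bounds(2) by linarith
      then show "Y \<xi> \<le> J" using \<tau>(4) by (subst (asm) mult_le_cancel_left_pos) auto
    qed
  qed
  finally show ?thesis .
qed

section \<open>Reduction to the conditionally Gaussian shift family\<close>

text \<open>Along a family linear in \<open>u\<close> the Gaussian log-likelihood is exactly
  quadratic in \<open>u\<close>, with no remainder term.\<close>

lemma ar_log_likelihood_eq: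
  assumes "\<And>k. k \<in> {1..n} \<Longrightarrow> S (real k / real n) = u * w k"
  shows "ar_log_likelihood n y0 S n y
    = u * (\<Sum>k=1..n. w k * (y(0 := y0)) (k - 1) * y k) - u\<^sup>2 * ar_information w n y0 y / 2"
proof -
  have "ar_log_likelihood n y0 S n y = (\<Sum>k=1..n. u * (w k * (y(0 := y0)) (k - 1) * y k)
      - u\<^sup>2 * (w k * (y(0 := y0)) (k - 1))\<^sup>2 / 2)"
    unfolding ar_log_likelihood_def
    by (intro sum.cong refl) (simp only: assms power_mult_distrib mult_ac)
  then show ?thesis
    unfolding ar_information_def by (simp only: sum_subtractf sum_distrib_left sum_divide_distrib)
qed

text \<open>The numerical hypotheses are conditions at a fixed \<open>n\<close>, to be met for all
  large \<open>n\<close>. The suprema are restricted to normal noise and the perturbations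
  \<open>S u\<close>; since \<open>S u z0 = u / \<phi>\<close>, the rescaled estimator
  \<open>\<phi> * T\<close> estimates \<open>u\<close>, and \<open>nh\<close> makes the weights
  satisfy the bounds \<open>sumw\<close>.\<close>

lemma weak_hoelder_risk_ge:
  fixes z0 L varsigma \<beta> \<epsilon> y0 e \<nu> b r J \<tau> \<delta> :: real and n :: nat
  defines "h \<equiv> bandwidth \<beta> n" and "\<phi> \<equiv> rate \<beta> n"
  defines "d \<equiv> b / \<phi>"
  assumes n: "0 < n" and varsigma: "1 \<le> varsigma" and e: "0 \<le> e" and \<nu>: "0 < \<nu>" and \<epsilon>: "0 < \<epsilon>"
    and h: "0 < h" and \<phi>: "0 < \<phi>" and nh: "real n * h = \<phi>\<^sup>2"
    and win: "(1 + \<nu>) * h + 1 / n \<le> z0" "z0 + (1 + \<nu>) * h \<le> 1"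
    and stable: "d \<le> 1 - \<epsilon>" "d * (4 / \<nu>) / h \<le> L"
    and \<tau>: "0 < \<tau>" "(1 + d)\<^sup>2 \<le> 2 - 1 / \<phi>\<^sup>2 - \<tau>"
      "(1 + d) * (2 * (1 + \<nu>) + 1 / \<phi>\<^sup>2 + \<tau>) \<le> (1 - d - d\<^sup>2) * J" "0 < 1 - d - d\<^sup>2"
    and r: "0 < r" "2 * r < b"
    and J: "1 / r \<le> sqrt (2 / (pi * J))"
    and \<delta>: "2 * (1 / \<phi>\<^sup>2 * (2 * (1 + \<nu>) + 1 / \<phi>\<^sup>2)) / \<tau>\<^sup>2 \<le> \<delta>" "\<delta> + 2 * exp (J / 2 - r) \<le> 1"
    and T [measurable]: "T \<in> borel_measurable (obs_space n)"
  shows "ennreal ((sqrt (2 / (pi * J)) - 1 / r) * (1 - 2 * r / b) * (1 - \<delta> - 2 * exp (J / 2 - r)))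
    \<le> (SUP S\<in>weak_hoelder_class z0 \<beta> n \<epsilon> L e.
        ennreal (stationary_factor z0 S powr (- 1 / 2) * rate \<beta> n) * robust_risk varsigma y0 z0 n T S)"
    (is "_ \<le> ?R")
proof -
  let ?P = "noise_law n std_normal_density"
  define w where "w k = 1 / \<phi> * cutoff \<nu> ((real k / n - z0) / h)" for k :: nat
  define S where "S u x = (u / \<phi>) * cutoff \<nu> ((x - z0) / h)" for u x
  define D where "D y = (\<Sum>k=1..n. w k * (y(0 := y0)) (k - 1) * y k)" for y :: "nat \<Rightarrow> real"
  let ?I = "ar_information w n y0"
  have Sw: "S u (real k / real n) = u * w k" for u k by (simp add: S_def w_def)
  have b: "0 < b" using r by simp
  have d: "0 < d" using b \<phi> by (simp add: d_def)
  have lik: "exp (ar_log_likelihood n y0 (S u) n y) = exp (u * D y - u\<^sup>2 * ?I y / 2)" for u y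
    using ar_log_likelihood_eq[of n "S u" u w y0 y] Sw by (simp add: D_def)
  have girsanov: "(\<integral>\<^sup>+ y. F y \<partial>obs_law n y0 (S u) std_normal_density)
      = (\<integral>\<^sup>+ y. F y * ennreal (exp (u * D y - u\<^sup>2 * ?I y / 2)) \<partial>?P)"
    if "F \<in> borel_measurable (obs_space n)" for F u
    using nn_integral_obs_law_std_normal[OF that, of y0 "S u"] by (simp add: lik)
  have [measurable]: "D \<in> borel_measurable (obs_space n)"
    unfolding D_def[abs_def]
    by (intro borel_measurable_sum borel_measurable_times borel_measurable_const measurable_lag
        measurable_component_singleton)
  have meas: "D \<in> borel_measurable ?P" "?I \<in> borel_measurable ?P" "(\<lambda>y. \<phi> * T y) \<in> borel_measurable ?P"
    by measurable
  have S_class: "S u \<in> weak_hoelder_class z0 \<beta> n \<epsilon> L e" if "\<bar>u\<bar> \<le> b" for u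
  proof -
    have ud: "\<bar>u / \<phi>\<bar> \<le> d" using that \<phi> by (simp add: d_def abs_divide divide_right_mono)
    have "\<bar>u / \<phi>\<bar> * (4 / \<nu>) / h \<le> d * (4 / \<nu>) / h"
      using ud \<nu> h by (intro divide_right_mono mult_right_mono) auto
    then have "S u \<in> stable_class \<epsilon> L"
      unfolding S_def[abs_def] using ud stable \<nu> h by (intro scaled_cutoff_in_stable_class) auto
    moreover have "local_osc h z0 (S u) = 0"
      unfolding S_def[abs_def] by (rule local_osc_scaled_cutoff[OF \<nu> h])
    ultimately show ?thesis using e by (simp add: weak_hoelder_class_def h_def)
  qed
  have S_z0: "S u z0 = u / \<phi>" for u using \<nu> by (simp add: S_def cutoff_eq_1)
  have risk: "(\<integral>\<^sup>+ y. ennreal (\<bar>\<phi> * T y - u\<bar> * exp (u * D y - u\<^sup>2 * ?I y / 2)) \<partial>?P) \<le> ?R"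
    if u: "\<bar>u\<bar> \<le> b" for u
  proof -
    have ud: "\<bar>u / \<phi>\<bar> \<le> d" using u \<phi> by (simp add: d_def abs_divide divide_right_mono)
    \<comment> \<open>The stationary factor lies in (0,1], so its power -1/2 is at least 1 and may
      be dropped from a lower bound.\<close>
    have "(u / \<phi>)\<^sup>2 < 1"
      using ud stable \<epsilon> by (simp add: abs_square_less_1)
    then have \<gamma>: "0 < stationary_factor z0 (S u)" "stationary_factor z0 (S u) \<le> 1"
      by (auto simp: stationary_factor_def S_z0)
    then have "stationary_factor z0 (S u) powr (1 / 2) \<le> 1" by (intro powr_le1) auto
    then have \<gamma>1: "1 \<le> stationary_factor z0 (S u) powr (- 1 / 2)"
      using \<gamma> by (simp add: powr_minus one_le_inverse_iff)
    have "(\<integral>\<^sup>+ y. ennreal (\<bar>\<phi> * T y - u\<bar> * exp (u * D y - u\<^sup>2 * ?I y / 2)) \<partial>?P)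
        = (\<integral>\<^sup>+ y. ennreal \<bar>\<phi> * T y - u\<bar> * ennreal (exp (u * D y - u\<^sup>2 * ?I y / 2)) \<partial>?P)"
      by (simp add: ennreal_mult)
    also have "\<dots> = (\<integral>\<^sup>+ y. ennreal \<bar>\<phi> * T y - u\<bar> \<partial>obs_law n y0 (S u) std_normal_density)"
      by (rule girsanov[symmetric]) measurable
    also have "\<dots> = (\<integral>\<^sup>+ y. ennreal \<phi> * ennreal \<bar>T y - S u z0\<bar> \<partial>obs_law n y0 (S u) std_normal_density)"
    proof (rule nn_integral_cong)
      fix y
      have "\<phi> * T y - u = \<phi> * (T y - S u z0)" using \<phi> by (simp add: S_z0 right_diff_distrib)
      then show "ennreal \<bar>\<phi> * T y - u\<bar> = ennreal \<phi> * ennreal \<bar>T y - S u z0\<bar>"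
        using \<phi> by (simp add: abs_mult ennreal_mult)
    qed
    also have "\<dots> = ennreal \<phi> * (\<integral>\<^sup>+ y. ennreal \<bar>T y - S u z0\<bar> \<partial>obs_law n y0 (S u) std_normal_density)"
      unfolding obs_law_def by (rule nn_integral_cmult) measurable
    also have "\<dots> \<le> ennreal (stationary_factor z0 (S u) powr (- 1 / 2) * \<phi>) * robust_risk varsigma y0 z0 n T (S u)"
      unfolding robust_risk_def using \<phi> \<gamma>1 std_normal_density_in_noise_densities[OF varsigma]
      by (intro mult_mono ennreal_leI SUP_upper) auto
    also have "\<dots> \<le> ?R"
      unfolding \<phi>_def by (rule SUP_upper[OF S_class[OF u]])
    finally show ?thesis .
  qed
  \<comment> \<open>The bump vanishes at \<open>1 / n\<close>, which removes \<open>y0\<close> from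
    the information, and at \<open>1 + 1 / n\<close>, one step beyond the last design point.\<close>
  have ends: "w 1 = 0" "w (Suc n) = 0"
  proof -
    have "1 + \<nu> \<le> \<bar>(1 / n - z0) / h\<bar>"
      using win h by (auto simp: abs_if field_simps)
    then show "w 1 = 0" using cutoff_eq_0[OF \<nu>] by (simp add: w_def)
    have "1 + \<nu> \<le> (real (Suc n) / n - z0) / h"
    proof -
      have "1 \<le> real (Suc n) / n" using n by (simp add: field_simps)
      then show ?thesis using win h by (simp add: pos_le_divide_eq)
    qed
    then have "1 + \<nu> \<le> \<bar>(real (Suc n) / n - z0) / h\<bar>" by linarith
    then show "w (Suc n) = 0" using cutoff_eq_0[OF \<nu>] by (simp add: w_def)
  qed
  have wa: "\<bar>w k\<bar> \<le> 1 / \<phi>" for k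
    using cutoff_bounds[OF \<nu>] \<phi> by (simp add: w_def abs_mult divide_right_mono)
  have sumw: "2 - 1 / \<phi>\<^sup>2 \<le> (\<Sum>k=1..n. (w k)\<^sup>2)" "(\<Sum>k=1..n. (w k)\<^sup>2) \<le> 2 * (1 + \<nu>) + 1 / \<phi>\<^sup>2"
  proof -
    let ?V = "\<Sum>k=1..n. (cutoff \<nu> ((k / n - z0) / h))\<^sup>2"
    have eq: "(\<Sum>k=1..n. (w k)\<^sup>2) = ?V / \<phi>\<^sup>2"
      by (simp add: w_def power_mult_distrib power_divide sum_divide_distrib)
    have "2 * \<phi>\<^sup>2 - 1 \<le> ?V" "?V \<le> 2 * (1 + \<nu>) * \<phi>\<^sup>2 + 1"
      using sum_cutoff_design_bounds[OF \<nu> h n win] unfolding nh by auto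
    then have "(2 * \<phi>\<^sup>2 - 1) / \<phi>\<^sup>2 \<le> ?V / \<phi>\<^sup>2" "?V / \<phi>\<^sup>2 \<le> (2 * (1 + \<nu>) * \<phi>\<^sup>2 + 1) / \<phi>\<^sup>2"
      by (auto intro!: divide_right_mono)
    then show "2 - 1 / \<phi>\<^sup>2 \<le> (\<Sum>k=1..n. (w k)\<^sup>2)" "(\<Sum>k=1..n. (w k)\<^sup>2) \<le> 2 * (1 + \<nu>) + 1 / \<phi>\<^sup>2"
      unfolding eq using \<phi> by (simp_all add: diff_divide_distrib add_divide_distrib)
  qed
  \<comment> \<open>Concentration is known for the path driven by the noise, that is, under the law
    of \<open>S u\<close>; the likelihood ratio carries it over to the reference law.\<close>
  have conc: "ennreal (1 - \<delta>) \<le> (\<integral>\<^sup>+ y. ennreal (exp (u * D y - u\<^sup>2 * ?I y / 2))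
      * indicator {y. 1 \<le> ?I y \<and> ?I y \<le> J} y \<partial>?P)" if u: "\<bar>u\<bar> \<le> b" for u
  proof -
    let ?path = "\<lambda>\<xi>. \<lambda>k\<in>{1..n}. ar_path n y0 (S u) \<xi> k"
    interpret P: prob_space ?P by (rule prob_space_PiM) (rule prob_space_std_normal)
    have ud: "\<bar>u\<bar> * (1 / \<phi>) \<le> d" using u \<phi> by (simp add: d_def divide_right_mono)
    have Im: "(\<lambda>\<xi>. ?I (?path \<xi>)) \<in> borel_measurable ?P"
      by (rule measurable_compose[OF measurable_ar_path measurable_ar_information])
    note [measurable] = Im
    have "1 - 2 * ((1 / \<phi>)\<^sup>2 * (2 * (1 + \<nu>) + 1 / \<phi>\<^sup>2)) / \<tau>\<^sup>2
        \<le> P.prob {\<xi> \<in> space ?P. 1 \<le> ?I (?path \<xi>) \<and> ?I (?path \<xi>) \<le> J}"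
      by (rule ar_information_concentration[OF Sw ends wa ud d sumw \<tau>])
    then have "1 - \<delta> \<le> P.prob {\<xi> \<in> space ?P. 1 \<le> ?I (?path \<xi>) \<and> ?I (?path \<xi>) \<le> J}"
      using \<delta>(1) by (simp add: power_one_over)
    then have "ennreal (1 - \<delta>) \<le> emeasure ?P {\<xi> \<in> space ?P. 1 \<le> ?I (?path \<xi>) \<and> ?I (?path \<xi>) \<le> J}"
      unfolding P.emeasure_eq_measure by (rule ennreal_leI)
    also have "\<dots> = (\<integral>\<^sup>+ \<xi>. indicator {\<xi> \<in> space ?P. 1 \<le> ?I (?path \<xi>) \<and> ?I (?path \<xi>) \<le> J} \<xi> \<partial>?P)"
      by (rule nn_integral_indicator[symmetric]) measurable
    also have "\<dots> = (\<integral>\<^sup>+ \<xi>. indicator {y. 1 \<le> ?I y \<and> ?I y \<le> J} (?path \<xi>) \<partial>?P)"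
      by (rule nn_integral_cong) (simp add: indicator_def)
    also have "\<dots> = (\<integral>\<^sup>+ y. indicator {y. 1 \<le> ?I y \<and> ?I y \<le> J} y \<partial>obs_law n y0 (S u) std_normal_density)"
      unfolding obs_law_def by (rule nn_integral_distr[OF measurable_ar_path, symmetric]) measurable
    also have "\<dots> = (\<integral>\<^sup>+ y. indicator {y. 1 \<le> ?I y \<and> ?I y \<le> J} y * ennreal (exp (u * D y - u\<^sup>2 * ?I y / 2)) \<partial>?P)"
      by (rule girsanov) measurable
    finally show ?thesis by (simp add: mult.commute)
  qed
  \<comment> \<open>The likelihood ratio represents the law of \<open>S u\<close>, a probability
    measure, for every real \<open>u\<close>.\<close>
  have one: "(\<integral>\<^sup>+ y. ennreal (exp (u * D y - u\<^sup>2 * ?I y / 2)) \<partial>?P) = 1" for u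
  proof -
    interpret O: prob_space "obs_law n y0 (S u) std_normal_density"
      using std_normal_density_in_noise_densities[OF order_refl] by (rule prob_space_obs_law)
    show ?thesis using girsanov[of "\<lambda>_. 1" u] O.emeasure_space_1 by simp
  qed
  have "0 \<le> 2 * (1 / \<phi>\<^sup>2 * (2 * (1 + \<nu>) + 1 / \<phi>\<^sup>2)) / \<tau>\<^sup>2" using \<nu> by simp
  then have "0 \<le> \<delta>" using \<delta>(1) by linarith
  then show ?thesis
    using conditionally_gaussian_minimax_abs_risk[OF prob_space_PiM meas one r J _ \<delta>(2) conc risk]
      prob_space_std_normal by blast
qed

section \<open>The asymptotic bound\<close>

text \<open>Rate times bandwidth is n^((beta - 1) / (2 beta + 1)), which diverges as beta > 1; hence
  the slopes of the perturbations tend to 0. The last identity balances the number of design points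
  in the window, of order n h, against the squared rate.\<close>

lemma bandwidth_rate_asymptotics:
  fixes \<beta> :: real
  assumes \<beta>: "1 < \<beta>"
  shows "bandwidth \<beta> \<longlonglongrightarrow> 0" "(\<lambda>n. 1 / rate \<beta> n) \<longlonglongrightarrow> 0"
    "(\<lambda>n. 1 / (rate \<beta> n * bandwidth \<beta> n)) \<longlonglongrightarrow> 0"
    "\<And>n. real n * bandwidth \<beta> n = (rate \<beta> n)\<^sup>2"
proof -
  have neg: "(\<lambda>n. real n powr s) \<longlonglongrightarrow> 0" if "s < 0" for s
    by (rule tendsto_neg_powr[OF that filterlim_real_sequentially])
  show "bandwidth \<beta> \<longlonglongrightarrow> 0"
    unfolding bandwidth_def[abs_def] using \<beta> by (intro neg) (simp add: divide_neg_pos)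
  have "(\<lambda>n. 1 / rate \<beta> n) = (\<lambda>n. real n powr (- (\<beta> / (2 * \<beta> + 1))))"
    by (rule ext) (simp add: rate_def powr_minus divide_inverse)
  then show "(\<lambda>n. 1 / rate \<beta> n) \<longlonglongrightarrow> 0" using \<beta> by (simp add: neg)
  have "rate \<beta> n * bandwidth \<beta> n = real n powr ((\<beta> - 1) / (2 * \<beta> + 1))" for n
    by (simp add: rate_def bandwidth_def diff_divide_distrib flip: powr_add)
  then have "(\<lambda>n. 1 / (rate \<beta> n * bandwidth \<beta> n)) = (\<lambda>n. real n powr (- ((\<beta> - 1) / (2 * \<beta> + 1))))"
    by (simp add: powr_minus inverse_eq_divide)
  then show "(\<lambda>n. 1 / (rate \<beta> n * bandwidth \<beta> n)) \<longlonglongrightarrow> 0" using \<beta> by (simp add: neg)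
  show "real n * bandwidth \<beta> n = (rate \<beta> n)\<^sup>2" for n
  proof (cases "n = 0")
    case False
    have "real n * bandwidth \<beta> n = real n powr (1 + - 1 / (2 * \<beta> + 1))"
      using False unfolding bandwidth_def powr_add by simp
    also have "1 + - 1 / (2 * \<beta> + 1) = \<beta> / (2 * \<beta> + 1) + \<beta> / (2 * \<beta> + 1)"
      using \<beta> unfolding add_divide_distrib[symmetric] by (simp add: divide_simps)
    finally show ?thesis unfolding powr_add by (simp add: rate_def power2_eq_square)
  qed (simp add: bandwidth_def rate_def)
qed

text \<open>First choose \<open>\<nu>\<close> close to 0: at 0 the square root is 1 / sqrt pi. Then
  let \<open>r\<close> grow with b = r^2 and delta = 1 / r, so that all the other terms
  disappear.\<close>

lemma minimax_constants_exist:
  fixes q :: real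
  assumes q: "q < 1 / sqrt pi"
  obtains \<nu> r :: real where "0 < \<nu>" "\<nu> < 1" "0 < r" "2 * r < r\<^sup>2"
    "1 / r \<le> sqrt (2 / (pi * (2 + 4 * \<nu>)))" "1 / r + 2 * exp ((2 + 4 * \<nu>) / 2 - r) \<le> 1"
    "q < (sqrt (2 / (pi * (2 + 4 * \<nu>))) - 1 / r) * (1 - 2 * r / r\<^sup>2)
      * (1 - 1 / r - 2 * exp ((2 + 4 * \<nu>) / 2 - r))"
proof -
  have "((\<lambda>\<nu>. sqrt (2 / (pi * (2 + 4 * \<nu>)))) \<longlongrightarrow> sqrt (2 / (pi * (2 + 4 * 0)))) (at_right 0)"
    by (intro tendsto_intros) auto
  moreover have "q < sqrt (2 / (pi * (2 + 4 * 0)))" using q by (simp add: real_sqrt_divide)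
  ultimately have "\<forall>\<^sub>F \<nu> in at_right 0. q < sqrt (2 / (pi * (2 + 4 * \<nu>)))" by (rule order_tendstoD)
  moreover have "\<forall>\<^sub>F \<nu> in at_right (0::real). 0 < \<nu>" "\<forall>\<^sub>F \<nu> in at_right (0::real). \<nu> < 1"
    by real_asymp+
  ultimately have "\<forall>\<^sub>F \<nu> in at_right 0. q < sqrt (2 / (pi * (2 + 4 * \<nu>))) \<and> 0 < \<nu> \<and> \<nu> < 1"
    by eventually_elim simp
  then obtain \<nu> where \<nu>: "q < sqrt (2 / (pi * (2 + 4 * \<nu>)))" "0 < \<nu>" "\<nu> < 1"
    using eventually_happens'[OF trivial_limit_at_right_real] by blast
  define c where "c = sqrt (2 / (pi * (2 + 4 * \<nu>)))"
  define J where "J = 2 + 4 * \<nu>"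
  have c: "0 < c" using \<nu> by (simp add: c_def)
  have "((\<lambda>r. (c - 1 / r) * (1 - 2 * r / r\<^sup>2) * (1 - 1 / r - 2 * exp (J / 2 - r))) \<longlongrightarrow> c) at_top"
    by real_asymp
  then have "\<forall>\<^sub>F r in at_top. q < (c - 1 / r) * (1 - 2 * r / r\<^sup>2) * (1 - 1 / r - 2 * exp (J / 2 - r))"
    using \<nu>(1) unfolding c_def by (rule order_tendstoD)
  moreover have "((\<lambda>r. 1 / r) \<longlongrightarrow> (0::real)) at_top" "((\<lambda>r. 1 / r + 2 * exp (J / 2 - r)) \<longlongrightarrow> 0) at_top"
    by real_asymp+
  then have "\<forall>\<^sub>F r in at_top. 1 / r < c" "\<forall>\<^sub>F r in at_top. 1 / r + 2 * exp (J / 2 - r) < 1"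
    using c by (auto intro: order_tendstoD)
  moreover have "\<forall>\<^sub>F r in at_top. (2::real) < r" by (rule eventually_gt_at_top)
  ultimately have "\<forall>\<^sub>F r in at_top. q < (c - 1 / r) * (1 - 2 * r / r\<^sup>2) * (1 - 1 / r - 2 * exp (J / 2 - r))
      \<and> 1 / r < c \<and> 1 / r + 2 * exp (J / 2 - r) < 1 \<and> 2 < r"
    by eventually_elim simp
  then obtain r where r: "q < (c - 1 / r) * (1 - 2 * r / r\<^sup>2) * (1 - 1 / r - 2 * exp (J / 2 - r))"
      "1 / r < c" "1 / r + 2 * exp (J / 2 - r) < 1" "2 < r"
    using eventually_happens'[OF trivial_limit_at_top_linorder] by blast
  show ?thesis
    by (rule that[OF \<nu>(2,3), of r], use r in \<open>auto simp: c_def J_def power2_eq_square\<close>)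
qed

lemma distributed_normal_expectation_abs:
  assumes "prob_space M" "distributed M lborel \<eta> (normal_density 0 (sqrt (1 / 2)))"
  shows "prob_space.expectation M (\<lambda>\<omega>. \<bar>\<eta> \<omega>\<bar>) = 1 / sqrt pi"
proof -
  interpret prob_space M by fact
  have "expectation (\<lambda>\<omega>. \<bar>\<eta> \<omega>\<bar>) = (\<integral>x. normal_density 0 (sqrt (1 / 2)) x * \<bar>x\<bar> \<partial>lborel)"
    using distributed_integral[OF assms(2), of "\<lambda>x. \<bar>x\<bar>"] by simp
  also have "\<dots> = sqrt (1 / 2) * sqrt (2 / pi)"
    using integral_normal_moment_abs_odd[of "sqrt (1 / 2)" 0 0] by simp
  also have "\<dots> = 1 / sqrt pi" by (simp add: real_sqrt_divide)
  finally show ?thesis .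
qed

theorem theorem3p1:
  fixes z0 L varsigma \<alpha> \<beta> \<epsilon> y0 :: real
    and eps_star :: "nat \<Rightarrow> real"
    and M :: "'a measure" and \<eta> :: "'a \<Rightarrow> real"
  assumes "0 < z0" "z0 < 1"
    and "0 < L"
    and "1 \<le> varsigma"
    and "0 < \<alpha>" "\<alpha> < 1" "\<beta> = 1 + \<alpha>"
    and "\<And>n. 1 \<le> n \<Longrightarrow> 0 < eps_star n"
    and "eps_star \<longlonglongrightarrow> 0"
    and "0 < \<epsilon>" "\<epsilon> < 1"
    and "prob_space M"
    and "distributed M lborel \<eta> (normal_density 0 (sqrt (1 / 2)))"
  shows "liminf (\<lambda>n. INF T\<in>borel_measurable (obs_space n).
            SUP S\<in>weak_hoelder_class z0 \<beta> n \<epsilon> L (eps_star n).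
              ennreal (stationary_factor z0 S powr (- 1 / 2) * rate \<beta> n)
                * robust_risk varsigma y0 z0 n T S)
         \<ge> ennreal (prob_space.expectation M (\<lambda>\<omega>. \<bar>\<eta> \<omega>\<bar>))"
  unfolding distributed_normal_expectation_abs[OF assms(12,13)] le_Liminf_iff
proof (intro allI impI)
  fix y :: ennreal assume y: "y < ennreal (1 / sqrt pi)"
  then obtain q where q: "0 \<le> q" "y = ennreal q" by (cases y) (auto simp: top_unique)
  then have "q < 1 / sqrt pi" using y by (simp add: ennreal_less_iff)
  then obtain \<nu> r where \<nu>: "0 < \<nu>" "\<nu> < 1" and r: "0 < r" "2 * r < r\<^sup>2"
    and J: "1 / r \<le> sqrt (2 / (pi * (2 + 4 * \<nu>)))" and \<delta>: "1 / r + 2 * exp ((2 + 4 * \<nu>) / 2 - r) \<le> 1"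
    and bound: "q < (sqrt (2 / (pi * (2 + 4 * \<nu>))) - 1 / r) * (1 - 2 * r / r\<^sup>2)
      * (1 - 1 / r - 2 * exp ((2 + 4 * \<nu>) / 2 - r))"
    by (rule minimax_constants_exist)
  define \<phi> where "\<phi> = rate \<beta>"
  define h where "h = bandwidth \<beta>"
  \<comment> \<open>With b = r^2, this is the largest absolute value taken by the perturbations at
    sample size \<open>n\<close>.\<close>
  define d where "d n = r\<^sup>2 / \<phi> n" for n
  have \<beta>: "1 < \<beta>" using assms by simp
  note asym = bandwidth_rate_asymptotics[OF \<beta>, folded \<phi>_def h_def]
  have d0: "d \<longlonglongrightarrow> 0"
    using tendsto_mult_right_zero[OF asym(2), of "r\<^sup>2"] by (simp add: d_def[abs_def])
  have \<phi>2: "(\<lambda>n. 1 / (\<phi> n)\<^sup>2) \<longlonglongrightarrow> 0"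
    using tendsto_power[OF asym(2), of 2] by (simp add: power_one_over)
  have dh: "(\<lambda>n. d n * (4 / \<nu>) / h n) \<longlonglongrightarrow> 0"
    using tendsto_mult_right_zero[OF asym(3), of "r\<^sup>2 * (4 / \<nu>)"] by (simp add: d_def[abs_def] mult_ac)
  have n1: "(\<lambda>n. 1 / real n) \<longlonglongrightarrow> 0" by (rule lim_1_over_n)
  have "(\<lambda>n. (1 + \<nu>) * h n + 1 / n) \<longlonglongrightarrow> (1 + \<nu>) * 0 + 0" by (intro tendsto_intros asym n1)
  then have e1: "\<forall>\<^sub>F n in sequentially. (1 + \<nu>) * h n + 1 / n < z0"
    by (rule order_tendstoD) (use assms in simp)
  have "(\<lambda>n. z0 + (1 + \<nu>) * h n) \<longlonglongrightarrow> z0 + (1 + \<nu>) * 0" by (intro tendsto_intros asym)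
  then have e2: "\<forall>\<^sub>F n in sequentially. z0 + (1 + \<nu>) * h n < 1"
    by (rule order_tendstoD) (use assms in simp)
  have e3: "\<forall>\<^sub>F n in sequentially. d n < 1 - \<epsilon>" by (rule order_tendstoD[OF d0]) (use assms in simp)
  have e4: "\<forall>\<^sub>F n in sequentially. d n * (4 / \<nu>) / h n < L" by (rule order_tendstoD[OF dh]) (use assms in simp)
  \<comment> \<open>With \<open>\<tau> = \<nu>\<close> the limiting inequality is 1 < 2 - nu, which
    is why \<open>\<nu>\<close> is below 1.\<close>
  have "(\<lambda>n. (1 + d n)\<^sup>2 - (2 - 1 / (\<phi> n)\<^sup>2 - \<nu>)) \<longlonglongrightarrow> (1 + 0)\<^sup>2 - (2 - 0 - \<nu>)"
    by (intro tendsto_intros d0 \<phi>2)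
  then have e5: "\<forall>\<^sub>F n in sequentially. (1 + d n)\<^sup>2 - (2 - 1 / (\<phi> n)\<^sup>2 - \<nu>) < 0"
    by (rule order_tendstoD) (use \<nu> in simp)
  \<comment> \<open>In the limit this is 2 + 3 nu < 2 + 4 nu; the value J = 2 + 4 nu leaves room for
    \<open>\<tau>\<close> above the total weight 2 + 2 nu.\<close>
  have "(\<lambda>n. (1 + d n) * (2 * (1 + \<nu>) + 1 / (\<phi> n)\<^sup>2 + \<nu>) - (1 - d n - (d n)\<^sup>2) * (2 + 4 * \<nu>))
      \<longlonglongrightarrow> (1 + 0) * (2 * (1 + \<nu>) + 0 + \<nu>) - (1 - 0 - 0\<^sup>2) * (2 + 4 * \<nu>)"
    by (intro tendsto_intros d0 \<phi>2)
  then have e6: "\<forall>\<^sub>F n in sequentially.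
      (1 + d n) * (2 * (1 + \<nu>) + 1 / (\<phi> n)\<^sup>2 + \<nu>) - (1 - d n - (d n)\<^sup>2) * (2 + 4 * \<nu>) < 0"
    by (rule order_tendstoD) (use \<nu> in simp)
  have "(\<lambda>n. 1 - d n - (d n)\<^sup>2) \<longlonglongrightarrow> 1 - 0 - 0\<^sup>2" by (intro tendsto_intros d0)
  then have e7: "\<forall>\<^sub>F n in sequentially. 0 < 1 - d n - (d n)\<^sup>2" by (rule order_tendstoD) simp
  \<comment> \<open>The Chebyshev bound on the exceptional probability falls below delta = 1 /
    r.\<close>
  have "(\<lambda>n. 2 * (1 / (\<phi> n)\<^sup>2 * (2 * (1 + \<nu>) + 1 / (\<phi> n)\<^sup>2)) / \<nu>\<^sup>2) \<longlonglongrightarrow> 2 * (0 * (2 * (1 + \<nu>) + 0)) / \<nu>\<^sup>2"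
    using \<nu> by (intro tendsto_intros \<phi>2) auto
  then have e8: "\<forall>\<^sub>F n in sequentially. 2 * (1 / (\<phi> n)\<^sup>2 * (2 * (1 + \<nu>) + 1 / (\<phi> n)\<^sup>2)) / \<nu>\<^sup>2 < 1 / r"
    by (rule order_tendstoD) (use r in simp)
  \<comment> \<open>The eight conditions involve \<open>n\<close> but no estimator, so the bound is
    uniform in \<open>T\<close> and passes to the infimum.\<close>
  show "\<forall>\<^sub>F n in sequentially. y < (INF T\<in>borel_measurable (obs_space n).
            SUP S\<in>weak_hoelder_class z0 \<beta> n \<epsilon> L (eps_star n).
              ennreal (stationary_factor z0 S powr (- 1 / 2) * rate \<beta> n)
                * robust_risk varsigma y0 z0 n T S)"
    using e1 e2 e3 e4 e5 e6 e7 e8 eventually_gt_at_top[of 0]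
  proof eventually_elim
    case (elim n)
    have pos: "0 < \<phi> n" "0 < h n"
      using elim(9) by (auto simp: \<phi>_def h_def rate_def bandwidth_def)
    have "y < ennreal ((sqrt (2 / (pi * (2 + 4 * \<nu>))) - 1 / r) * (1 - 2 * r / r\<^sup>2)
      * (1 - 1 / r - 2 * exp ((2 + 4 * \<nu>) / 2 - r)))"
      unfolding q using q bound by (simp add: ennreal_less_iff)
    also have "\<dots> \<le> (INF T\<in>borel_measurable (obs_space n).
            SUP S\<in>weak_hoelder_class z0 \<beta> n \<epsilon> L (eps_star n).
              ennreal (stationary_factor z0 S powr (- 1 / 2) * rate \<beta> n)
                * robust_risk varsigma y0 z0 n T S)"
      by (rule INF_greatest, rule weak_hoelder_risk_ge[where \<tau>=\<nu> and \<nu>=\<nu>])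
         (use elim pos \<nu> r J \<delta> assms(4,8,10) asym(4)[of n] in \<open>simp_all add: d_def \<phi>_def h_def less_imp_le\<close>)
    finally show ?case .
  qed
qed

end
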